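(* Let $(\Omega,\mathfrak{A},\mu)$ and $(\Gamma,\mathfrak{B},\nu)$ be (arbitrary) measure spaces. Suppose that $\Phi:L^\infty(\mu)_+^{\mathrm{sp}}\to L^\infty(\nu)_+^{\mathrm{sp}}$ is a metric preserving bijection, i.e. a bijection with $\|\Phi(f)-\Phi(g)\|_\infty=\|f-g\|_\infty$ for all $f,g\in L^\infty(\mu)_+^{\mathrm{sp}}$. Then $\Phi$ extends to a $^*$-isomorphism from $L^\infty(\mu)$ onto $L^\infty(\nu)$. More precisely, there is a regular set isomorphism $\Lambda:\mathfrak{A}\to\mathfrak{B}$ such that $\Phi(g)=\widehat{\Lambda}(g)$ for all $g\in L^\infty(\mu)_+^{\mathrm{sp}}$.
   Context: $L^\infty(\mu):=M^\infty(\mu)/N^\infty(\mu)$, where $M^\infty(\mu)$ is the algebra of all bounded complex-valued $\mathfrak{A}$-measurable functions and $N^\infty(\mu):=\{f\in M^\infty(\mu):\mu(\{x\in\Omega:f(x)\neq 0\})=0\}$, with the essential supremum norm. $L^\infty(\mu)_+^{\mathrm{sp}}:=\{f\in L^\infty(\mu): f\geq 0\ \mu\text{-a.e.},\ \|f\|_\infty=1\}$. For $E,F\in\mathfrak{A}$ write $E\equiv F$ if $\mu(E\setminus F)=\mu(F\setminus E)=0$; similarly in $\mathfrak{B}$ with $\nu$. A map $\Lambda:\mathfrak{A}\to\mathfrak{B}$ is a regular set isomorphism if: $\Lambda(A)\equiv\emptyset$ if and only if $A\equiv\emptyset$ ($A\in\mathfrak{A}$); $\Lambda(A_1\setminus A_2)\equiv\Lambda(A_1)\setminus\Lambda(A_2)$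 ($A_1,A_2\in\mathfrak{A}$); and for any $B\in\mathfrak{B}$ there is $A\in\mathfrak{A}$ with $\Lambda(A)\equiv B$. For such $\Lambda$, $\widehat{\Lambda}:L^\infty(\mu)\to L^\infty(\nu)$ denotes the isometric order isomorphism ($^*$-isomorphism) determined by linearity, norm continuity and $\widehat{\Lambda}(\mathbf 1_A)=\mathbf 1_{\Lambda(A)}$ for $A\in\mathfrak{A}$. *)

theory Defs
  imports "HOL-Probability.Essential_Supremum"
begin

text \<open>Bounded measurable functions are total functions on the underlying type; only their values on
  \<open>space M\<close> matter, and functions that agree there are identified in the quotient.\<close>

definition Minf :: "'a measure \<Rightarrow> ('a \<Rightarrow> complex) set" where
  "Minf M = {f \<in> borel_measurable M. bounded (f ` space M)}"

definition Ninf :: "'a measure \<Rightarrow> ('a \<Rightarrow> complex) set" where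
  "Ninf M = {f \<in> Minf M. emeasure M {x \<in> space M. f x \<noteq> 0} = 0}"

definition Linf_rel :: "'a measure \<Rightarrow> (('a \<Rightarrow> complex) \<times> ('a \<Rightarrow> complex)) set" where
  "Linf_rel M = {(f, g). f \<in> Minf M \<and> g \<in> Minf M \<and> (\<lambda>x. f x - g x) \<in> Ninf M}"

definition Linf :: "'a measure \<Rightarrow> ('a \<Rightarrow> complex) set set" where
  "Linf M = Minf M // Linf_rel M"

definition Linf_class :: "'a measure \<Rightarrow> ('a \<Rightarrow> complex) \<Rightarrow> ('a \<Rightarrow> complex) set" where
  "Linf_class M f = Linf_rel M `` {f}"

text \<open>The operations are lifted from representatives; each union below ranges over a family
  whose members all coincide (lemmas \<open>Linf_add_class\<close> to \<open>Linf_star_class\<close>).\<close>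

definition Linf_add where
  "Linf_add M F G = (\<Union>f\<in>F. \<Union>g\<in>G. Linf_class M (\<lambda>x. f x + g x))"

definition Linf_diff where
  "Linf_diff M F G = (\<Union>f\<in>F. \<Union>g\<in>G. Linf_class M (\<lambda>x. f x - g x))"

definition Linf_mult where
  "Linf_mult M F G = (\<Union>f\<in>F. \<Union>g\<in>G. Linf_class M (\<lambda>x. f x * g x))"

definition Linf_scale where
  "Linf_scale M c F = (\<Union>f\<in>F. Linf_class M (\<lambda>x. c * f x))"

definition Linf_star where
  "Linf_star M F = (\<Union>f\<in>F. Linf_class M (\<lambda>x. cnj (f x)))"

text \<open>On a measure space with \<open>emeasure M (space M) = 0\<close> the essential supremum is \<open>-\<infinity>\<close>, which
  \<open>real_of_ereal\<close> sends to \<open>0\<close>, the norm of the only element.\<close>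

definition Linf_norm :: "'a measure \<Rightarrow> ('a \<Rightarrow> complex) set \<Rightarrow> real" where
  "Linf_norm M F = the_elem ((\<lambda>f. real_of_ereal (esssup M (\<lambda>x. ereal (cmod (f x))))) ` F)"

definition Linf_possphere :: "'a measure \<Rightarrow> ('a \<Rightarrow> complex) set set" where
  "Linf_possphere M =
     {F \<in> Linf M. (\<forall>f\<in>F. AE x in M. f x \<in> \<real>\<^sub>\<ge>\<^sub>0) \<and> Linf_norm M F = 1}"

definition set_equiv :: "'a measure \<Rightarrow> 'a set \<Rightarrow> 'a set \<Rightarrow> bool" where
  "set_equiv M E F \<longleftrightarrow> emeasure M (E - F) = 0 \<and> emeasure M (F - E) = 0"

definition regular_set_isomorphism ::
  "'a measure \<Rightarrow> 'b measure \<Rightarrow> ('a set \<Rightarrow> 'b set) \<Rightarrow> bool" where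
  "regular_set_isomorphism M N \<Lambda> \<longleftrightarrow>
     \<Lambda> \<in> sets M \<rightarrow> sets N \<and>
     (\<forall>A\<in>sets M. set_equiv N (\<Lambda> A) {} \<longleftrightarrow> set_equiv M A {}) \<and>
     (\<forall>A1\<in>sets M. \<forall>A2\<in>sets M. set_equiv N (\<Lambda> (A1 - A2)) (\<Lambda> A1 - \<Lambda> A2)) \<and>
     (\<forall>B\<in>sets N. \<exists>A\<in>sets M. set_equiv N (\<Lambda> A) B)"

definition Linf_linear ::
  "'a measure \<Rightarrow> 'b measure \<Rightarrow> (('a \<Rightarrow> complex) set \<Rightarrow> ('b \<Rightarrow> complex) set) \<Rightarrow> bool" where
  "Linf_linear M N T \<longleftrightarrow>
     (\<forall>F\<in>Linf M. \<forall>G\<in>Linf M. T (Linf_add M F G) = Linf_add N (T F) (T G)) \<and>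
     (\<forall>c. \<forall>F\<in>Linf M. T (Linf_scale M c F) = Linf_scale N c (T F))"

definition Linf_norm_continuous ::
  "'a measure \<Rightarrow> 'b measure \<Rightarrow> (('a \<Rightarrow> complex) set \<Rightarrow> ('b \<Rightarrow> complex) set) \<Rightarrow> bool" where
  "Linf_norm_continuous M N T \<longleftrightarrow>
     (\<forall>F\<in>Linf M. \<forall>e>0. \<exists>d>0. \<forall>G\<in>Linf M.
        Linf_norm M (Linf_diff M G F) < d \<longrightarrow> Linf_norm N (Linf_diff N (T G) (T F)) < e)"

definition Linf_star_isomorphism ::
  "'a measure \<Rightarrow> 'b measure \<Rightarrow> (('a \<Rightarrow> complex) set \<Rightarrow> ('b \<Rightarrow> complex) set) \<Rightarrow> bool" where
  "Linf_star_isomorphism M N T \<longleftrightarrow>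
     bij_betw T (Linf M) (Linf N) \<and>
     Linf_linear M N T \<and>
     (\<forall>F\<in>Linf M. \<forall>G\<in>Linf M. T (Linf_mult M F G) = Linf_mult N (T F) (T G)) \<and>
     (\<forall>F\<in>Linf M. T (Linf_star M F) = Linf_star N (T F))"

text \<open>For a regular set isomorphism the description below is satisfied by exactly one map:
  simple functions are dense, and \<open>\<rightarrow>\<^sub>E\<close> fixes the values outside \<open>Linf M\<close>.\<close>

definition Linf_hat ::
  "'a measure \<Rightarrow> 'b measure \<Rightarrow> ('a set \<Rightarrow> 'b set) \<Rightarrow> ('a \<Rightarrow> complex) set \<Rightarrow> ('b \<Rightarrow> complex) set" where
  "Linf_hat M N \<Lambda> = (THE T.
     T \<in> Linf M \<rightarrow>\<^sub>E Linf N \<and>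
     Linf_linear M N T \<and>
     Linf_norm_continuous M N T \<and>
     (\<forall>A\<in>sets M. T (Linf_class M (indicator A)) = Linf_class N (indicator (\<Lambda> A))))"

lemma Minf_diff: "f \<in> Minf M \<Longrightarrow> g \<in> Minf M \<Longrightarrow> (\<lambda>x. f x - g x) \<in> Minf M"
  by (auto simp: Minf_def intro: bounded_minus_comp)

lemma Linf_rel_iff:
  "(f, g) \<in> Linf_rel M \<longleftrightarrow> f \<in> Minf M \<and> g \<in> Minf M \<and> (AE x in M. f x = g x)"
proof -
  have "(AE x in M. f x = g x) \<longleftrightarrow> emeasure M {x \<in> space M. f x - g x \<noteq> 0} = 0"
    if "f \<in> Minf M" "g \<in> Minf M"
  proof -
    have [measurable]: "f \<in> borel_measurable M" "g \<in> borel_measurable M"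
      using that by (auto simp: Minf_def)
    have "{x \<in> space M. f x - g x \<noteq> 0} \<in> sets M" by measurable
    moreover have "{x \<in> space M. \<not> f x = g x} = {x \<in> space M. f x - g x \<noteq> 0}" by simp
    ultimately show ?thesis by (rule AE_iff_measurable)
  qed
  moreover have "(\<lambda>x. f x - g x) \<in> Minf M" if "f \<in> Minf M" "g \<in> Minf M"
    using that by (rule Minf_diff)
  ultimately show ?thesis unfolding Linf_rel_def Ninf_def mem_Collect_eq prod.case by metis
qed

lemma equiv_Linf_rel: "equiv (Minf M) (Linf_rel M)"
proof (rule equivI)
  show "Linf_rel M \<subseteq> Minf M \<times> Minf M" by (auto simp: Linf_rel_iff)
  show "refl_on (Minf M) (Linf_rel M)" by (auto simp: refl_on_def Linf_rel_iff)
  show "sym (Linf_rel M)"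
  proof (rule symI)
    fix f g assume fg: "(f, g) \<in> Linf_rel M"
    then have "AE x in M. f x = g x" by (simp add: Linf_rel_iff)
    then have "AE x in M. g x = f x" by eventually_elim simp
    with fg show "(g, f) \<in> Linf_rel M" by (simp add: Linf_rel_iff)
  qed
  show "trans (Linf_rel M)"
  proof (rule transI)
    fix f g h assume fg: "(f, g) \<in> Linf_rel M" and gh: "(g, h) \<in> Linf_rel M"
    then have "AE x in M. f x = g x" "AE x in M. g x = h x" by (simp_all add: Linf_rel_iff)
    then have "AE x in M. f x = h x" by eventually_elim simp
    with fg gh show "(f, h) \<in> Linf_rel M" by (simp add: Linf_rel_iff)
  qed
qed

lemma Linf_class_in_Linf: "f \<in> Minf M \<Longrightarrow> Linf_class M f \<in> Linf M"
  by (simp add: Linf_class_def Linf_def quotientI)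

lemma Linf_eq_image: "Linf M = Linf_class M ` Minf M"
  by (auto simp: Linf_def Linf_class_def quotient_def)

lemma Linf_class_eqI:
  assumes "f \<in> Minf M" "g \<in> Minf M" "AE x in M. f x = g x"
  shows "Linf_class M f = Linf_class M g"
  unfolding Linf_class_def by (rule equiv_class_eq[OF equiv_Linf_rel]) (simp add: Linf_rel_iff assms)

lemma Linf_class_iff:
  "f \<in> Minf M \<Longrightarrow> g \<in> Linf_class M f \<longleftrightarrow> g \<in> Minf M \<and> (AE x in M. f x = g x)"
  by (auto simp: Linf_class_def Linf_rel_iff)

lemma Linf_class_self: "f \<in> Minf M \<Longrightarrow> f \<in> Linf_class M f"
  by (simp add: Linf_class_iff)

lemma Minf_add: "f \<in> Minf M \<Longrightarrow> g \<in> Minf M \<Longrightarrow> (\<lambda>x. f x + g x) \<in> Minf M"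
  by (auto simp: Minf_def intro: bounded_plus_comp)

lemma Minf_mult:
  assumes "f \<in> Minf M" "g \<in> Minf M" shows "(\<lambda>x. f x * g x) \<in> Minf M"
proof -
  obtain a where a: "\<And>x. x \<in> space M \<Longrightarrow> cmod (f x) \<le> a"
    using assms(1) by (auto simp: Minf_def bounded_iff)
  obtain b where b: "\<And>x. x \<in> space M \<Longrightarrow> cmod (g x) \<le> b"
    using assms(2) by (auto simp: Minf_def bounded_iff)
  have "cmod (f x * g x) \<le> a * b" if "x \<in> space M" for x
    unfolding norm_mult using a[OF that] b[OF that] order_trans[OF norm_ge_zero a[OF that]]
    by (intro mult_mono) auto
  then have "bounded ((\<lambda>x. f x * g x) ` space M)"
    unfolding bounded_iff by blast
  moreover have "(\<lambda>x. f x * g x) \<in> borel_measurable M"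
    using assms by (intro borel_measurable_times) (simp_all add: Minf_def)
  ultimately show ?thesis by (simp add: Minf_def)
qed

lemma Minf_const: "(\<lambda>x. c) \<in> Minf M"
  by (auto simp: Minf_def bounded_iff)

lemma Minf_cnj:
  assumes "f \<in> Minf M" shows "(\<lambda>x. cnj (f x)) \<in> Minf M"
proof -
  have "cnj \<in> borel_measurable borel"
    by (intro borel_measurable_continuous_onI continuous_on_cnj continuous_on_id)
  then have "(\<lambda>x. cnj (f x)) \<in> borel_measurable M"
    using assms measurable_compose unfolding Minf_def by blast
  moreover have "bounded ((\<lambda>x. cnj (f x)) ` space M)"
    using assms by (simp add: Minf_def bounded_iff)
  ultimately show ?thesis by (simp add: Minf_def)
qed

lemma Minf_indicator: "A \<in> sets M \<Longrightarrow> indicator A \<in> Minf M"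
proof -
  have "bounded (range (indicator A :: _ \<Rightarrow> complex))"
    by (rule finite_imp_bounded, rule finite_subset[of _ "{0, 1}"]) (auto simp: indicator_def)
  then show "indicator A \<in> Minf M" if "A \<in> sets M"
    using that by (auto simp: Minf_def intro: bounded_subset)
qed

context
  fixes M :: "'a measure" and f g :: "'a \<Rightarrow> complex"
  assumes f: "f \<in> Minf M"
begin

lemma Linf_unary_class:
  assumes "\<And>h. h \<in> Minf M \<Longrightarrow> (\<lambda>x. op1 (h x)) \<in> Minf M"
  shows "(\<Union>h\<in>Linf_class M f. Linf_class M (\<lambda>x. op1 (h x))) = Linf_class M (\<lambda>x. op1 (f x))"
proof -
  have "Linf_class M (\<lambda>x. op1 (h x)) = Linf_class M (\<lambda>x. op1 (f x))" if "h \<in> Linf_class M f" for h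
  proof (rule Linf_class_eqI)
    have "AE x in M. f x = h x" using that f by (simp add: Linf_class_iff)
    then show "AE x in M. op1 (h x) = op1 (f x)" by eventually_elim simp
  next
    show "(\<lambda>x. op1 (h x)) \<in> Minf M" "(\<lambda>x. op1 (f x)) \<in> Minf M"
      using that f by (simp_all only: assms Linf_class_iff)
  qed
  then show ?thesis by (intro UN_constant_eq[OF Linf_class_self[OF f]]) blast
qed

lemma Linf_scale_class: "Linf_scale M c (Linf_class M f) = Linf_class M (\<lambda>x. c * f x)"
  unfolding Linf_scale_def by (rule Linf_unary_class) (rule Minf_mult[OF Minf_const])

lemma Linf_star_class: "Linf_star M (Linf_class M f) = Linf_class M (\<lambda>x. cnj (f x))"
  unfolding Linf_star_def by (rule Linf_unary_class) (rule Minf_cnj)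

lemma Linf_norm_class:
  "Linf_norm M (Linf_class M f) = real_of_ereal (esssup M (\<lambda>x. ereal (cmod (f x))))"
proof -
  have "esssup M (\<lambda>x. ereal (cmod (h x))) = esssup M (\<lambda>x. ereal (cmod (f x)))"
    if "h \<in> Linf_class M f" for h
  proof (rule esssup_AE_cong)
    have "AE x in M. f x = h x" using that f by (simp add: Linf_class_iff)
    then show "AE x in M. ereal (cmod (h x)) = ereal (cmod (f x))" by eventually_elim simp
  next
    have "h \<in> borel_measurable M" "f \<in> borel_measurable M"
      using that f by (simp_all add: Linf_class_iff Minf_def)
    then show "(\<lambda>x. ereal (cmod (h x))) \<in> borel_measurable M"
      "(\<lambda>x. ereal (cmod (f x))) \<in> borel_measurable M" by measurable
  qed
  note norm_eq = arg_cong[where f = real_of_ereal, OF this]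
  have "Linf_class M f \<noteq> {}" using Linf_class_self[OF f] by blast
  then show ?thesis unfolding Linf_norm_def by (rule the_elem_image_unique) (rule norm_eq)
qed

lemma Linf_binary_class:
  assumes g: "g \<in> Minf M"
    and "\<And>h k. h \<in> Minf M \<Longrightarrow> k \<in> Minf M \<Longrightarrow> (\<lambda>x. op2 (h x) (k x)) \<in> Minf M"
  shows "(\<Union>h\<in>Linf_class M f. \<Union>k\<in>Linf_class M g. Linf_class M (\<lambda>x. op2 (h x) (k x))) =
    Linf_class M (\<lambda>x. op2 (f x) (g x))"
proof -
  have "Linf_class M (\<lambda>x. op2 (h x) (k x)) = Linf_class M (\<lambda>x. op2 (f x) (g x))"
    if "h \<in> Linf_class M f" "k \<in> Linf_class M g" for h k
  proof (rule Linf_class_eqI)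
    have "AE x in M. f x = h x" "AE x in M. g x = k x"
      using that f g by (auto simp: Linf_class_iff)
    then show "AE x in M. op2 (h x) (k x) = op2 (f x) (g x)" by eventually_elim simp
  next
    have "h \<in> Minf M" "k \<in> Minf M" using that f g by (simp_all add: Linf_class_iff)
    then show "(\<lambda>x. op2 (h x) (k x)) \<in> Minf M" "(\<lambda>x. op2 (f x) (g x)) \<in> Minf M"
      using f g assms(2) by blast+
  qed
  then show ?thesis
    by (intro UN_constant_eq[OF Linf_class_self[OF f]] UN_constant_eq[OF Linf_class_self[OF g]] ballI)
qed

lemma Linf_add_class:
  "g \<in> Minf M \<Longrightarrow> Linf_add M (Linf_class M f) (Linf_class M g) = Linf_class M (\<lambda>x. f x + g x)"
  unfolding Linf_add_def by (rule Linf_binary_class) (auto intro: Minf_add)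

lemma Linf_diff_class:
  "g \<in> Minf M \<Longrightarrow> Linf_diff M (Linf_class M f) (Linf_class M g) = Linf_class M (\<lambda>x. f x - g x)"
  unfolding Linf_diff_def by (rule Linf_binary_class) (auto intro: Minf_diff)

lemma Linf_mult_class:
  "g \<in> Minf M \<Longrightarrow> Linf_mult M (Linf_class M f) (Linf_class M g) = Linf_class M (\<lambda>x. f x * g x)"
  unfolding Linf_mult_def by (rule Linf_binary_class) (auto intro: Minf_mult)

end

end

theory Submission
  imports Defs
begin

text \<open>
  In the positive unit sphere the metric recognises indicator functions: \<open>a\<close> is one exactly if the
  open unit ball around \<open>a\<close> contains the open unit ball around no other point of the sphere. Two
  sets are disjoint up to a null set exactly if the open unit balls around their indicators do not
  meet. Hence \<open>\<Phi>\<close> induces a map \<open>\<Lambda>\<close> of sets that preserves disjointness in both directions and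
  is onto modulo null sets, which makes it a regular set isomorphism.

  A regular set isomorphism preserves countable unions modulo null sets, so it transports the
  preimages of Borel sets under any bounded measurable function; this gives \<open>\<Lambda>\<close>-hat. Finally, for
  \<open>1/2 \<le> s < 1\<close> the indicators within distance \<open>s\<close> of \<open>r\<close> are those of the sets between
  \<open>{r > s}\<close> and \<open>{r \<ge> 1 - s}\<close>. Therefore \<open>\<Lambda>\<close> maps these level sets of \<open>r\<close> to the level sets of
  \<open>\<Phi> r\<close>, and since \<open>s\<close> ranges over \<open>[1/2, 1)\<close> this determines \<open>\<Phi> r\<close>.
\<close>

section \<open>Regular set isomorphisms\<close>

lemma set_equiv_AE_iff:
  assumes "A \<in> sets M" "B \<in> sets M"
  shows "set_equiv M A B \<longleftrightarrow> (AE x in M. x \<in> A \<longleftrightarrow> x \<in> B)"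
proof -
  have 1: "emeasure M (A - B) = 0 \<longleftrightarrow> (AE x in M. x \<notin> A - B)"
    using assms AE_iff_null_sets[of "A - B" M] by (auto simp: null_sets_def)
  have 2: "emeasure M (B - A) = 0 \<longleftrightarrow> (AE x in M. x \<notin> B - A)"
    using assms AE_iff_null_sets[of "B - A" M] by (auto simp: null_sets_def)
  show ?thesis unfolding set_equiv_def 1 2 AE_conj_iff[symmetric]
    by (intro AE_cong) auto
qed

text \<open>The almost-everywhere form of \<open>regular_set_isomorphism\<close>: identities modulo
  null sets become pointwise statements about membership, which combine freely under
  \<open>AE\<close>.\<close>

locale regular_iso =
  fixes M :: "'a measure" and N :: "'b measure" and L :: "'a set \<Rightarrow> 'b set"
  assumes L_in [measurable]: "\<And>A. A \<in> sets M \<Longrightarrow> L A \<in> sets N"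
    and L_null: "\<And>A. A \<in> sets M \<Longrightarrow> (AE y in N. y \<notin> L A) \<longleftrightarrow> (AE x in M. x \<notin> A)"
    and L_diff: "\<And>A B. A \<in> sets M \<Longrightarrow> B \<in> sets M \<Longrightarrow>
      AE y in N. y \<in> L (A - B) \<longleftrightarrow> y \<in> L A \<and> y \<notin> L B"
    and L_surj: "\<And>B. B \<in> sets N \<Longrightarrow> \<exists>A\<in>sets M. AE y in N. y \<in> L A \<longleftrightarrow> y \<in> B"

lemma regular_iso_iff: "regular_iso M N L \<longleftrightarrow> regular_set_isomorphism M N L"
proof
  assume "regular_iso M N L"
  then interpret regular_iso M N L .
  show "regular_set_isomorphism M N L"
    unfolding regular_set_isomorphism_def
    by (intro conjI ballI funcsetI)
      (insert L_null L_diff L_surj, auto simp: set_equiv_AE_iff sets.Diff)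
next
  assume "regular_set_isomorphism M N L"
  then have *: "\<And>A. A \<in> sets M \<Longrightarrow> L A \<in> sets N"
    "\<And>A. A \<in> sets M \<Longrightarrow> set_equiv N (L A) {} \<longleftrightarrow> set_equiv M A {}"
    "\<And>A B. A \<in> sets M \<Longrightarrow> B \<in> sets M \<Longrightarrow> set_equiv N (L (A - B)) (L A - L B)"
    "\<And>B. B \<in> sets N \<Longrightarrow> \<exists>A\<in>sets M. set_equiv N (L A) B"
    by (auto simp: regular_set_isomorphism_def)
  show "regular_iso M N L"
  proof
    fix A B assume "A \<in> sets M" "B \<in> sets M"
    then show "AE y in N. y \<in> L (A - B) \<longleftrightarrow> y \<in> L A \<and> y \<notin> L B"
      using *(3)[of A B] *(1) by (simp add: set_equiv_AE_iff sets.Diff)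
  next
    fix A assume "A \<in> sets M"
    then show "(AE y in N. y \<notin> L A) \<longleftrightarrow> (AE x in M. x \<notin> A)"
      using *(2)[of A] *(1) by (simp add: set_equiv_AE_iff)
  next
    fix B assume "B \<in> sets N"
    then show "\<exists>A\<in>sets M. AE y in N. y \<in> L A \<longleftrightarrow> y \<in> B"
      using *(4)[of B] *(1) by (auto simp: set_equiv_AE_iff)
  qed (use * in auto)
qed

section \<open>Boolean operations and countable unions modulo null sets\<close>

context regular_iso
begin

lemma L_empty: "AE y in N. y \<notin> L {}"
  using L_null[of "{}"] by simp

lemma L_mono:
  assumes "A \<in> sets M" "B \<in> sets M" "A \<subseteq> B"
  shows "AE y in N. y \<in> L A \<longrightarrow> y \<in> L B"
proof -
  have "A - B = {}" using assms by auto
  with L_diff[OF assms(1,2)] L_empty show ?thesis by auto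
qed

text \<open>Surjectivity makes \<open>L\<close> unital: some \<open>A\<close> is mapped onto
  \<open>space N\<close> up to a null set, and \<open>A\<close> is contained in
  \<open>space M\<close>.\<close>

lemma L_space: "AE y in N. y \<in> L (space M)"
proof -
  obtain A where A: "A \<in> sets M" "AE y in N. y \<in> L A \<longleftrightarrow> y \<in> space N"
    using L_surj[of "space N"] by auto
  have "AE y in N. y \<in> L A \<longrightarrow> y \<in> L (space M)"
    using A by (intro L_mono) (auto dest: sets.sets_into_space)
  with A(2) AE_space[of N] show ?thesis by eventually_elim auto
qed

lemma L_Int:
  assumes "A \<in> sets M" "B \<in> sets M"
  shows "AE y in N. y \<in> L (A \<inter> B) \<longleftrightarrow> y \<in> L A \<and> y \<in> L B"
proof -
  have "A \<inter> B = A - (A - B)" by auto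
  with L_diff[of A "A - B"] L_diff[of A B] assms show ?thesis by auto
qed

lemma L_AE_disjoint_iff:
  assumes "A \<in> sets M" "B \<in> sets M"
  shows "(AE y in N. y \<in> L A \<longrightarrow> y \<notin> L B) \<longleftrightarrow> (AE x in M. x \<in> A \<longrightarrow> x \<notin> B)"
proof -
  have "(AE y in N. y \<in> L A \<longrightarrow> y \<notin> L B) \<longleftrightarrow> (AE y in N. y \<notin> L (A \<inter> B))"
    by (rule eventually_subst[OF eventually_mono[OF L_Int[OF assms]]]) auto
  also have "\<dots> \<longleftrightarrow> (AE x in M. x \<notin> A \<inter> B)"
    using assms by (intro L_null) auto
  finally show ?thesis by auto
qed

lemma L_AE_subset_iff:
  assumes "A \<in> sets M" "B \<in> sets M"
  shows "(AE y in N. y \<in> L A \<longrightarrow> y \<in> L B) \<longleftrightarrow> (AE x in M. x \<in> A \<longrightarrow> x \<in> B)"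
proof -
  have "(AE y in N. y \<in> L A \<longrightarrow> y \<in> L B) \<longleftrightarrow> (AE y in N. y \<notin> L (A - B))"
    by (rule eventually_subst[OF eventually_mono[OF L_diff[OF assms]]]) auto
  also have "\<dots> \<longleftrightarrow> (AE x in M. x \<notin> A - B)"
    using assms by (intro L_null) auto
  finally show ?thesis by auto
qed

lemma L_AE_eq_iff:
  assumes "A \<in> sets M" "B \<in> sets M"
  shows "(AE y in N. y \<in> L A \<longleftrightarrow> y \<in> L B) \<longleftrightarrow> (AE x in M. x \<in> A \<longleftrightarrow> x \<in> B)"
  using L_AE_subset_iff[OF assms] L_AE_subset_iff[OF assms(2,1)]
  unfolding iff_conv_conj_imp AE_conj_iff by blast

lemmas L_AE_cong = L_AE_eq_iff[THEN iffD2]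

text \<open>Countable additivity comes from surjectivity. The excess of \<open>L\<close> of the
  union over the union of the images is itself an image \<open>L C\<close>. Then \<open>C\<close> is
  almost disjoint from every \<open>A n\<close>, hence from their union, so \<open>L C\<close> is
  almost disjoint from the image of the union, in which it lies. Thus the excess is null.\<close>

lemma L_UN:
  fixes A :: "nat \<Rightarrow> 'a set"
  assumes A [measurable]: "\<And>n. A n \<in> sets M"
  shows "AE y in N. y \<in> L (\<Union>n. A n) \<longleftrightarrow> (\<exists>n. y \<in> L (A n))"
proof -
  have [measurable]: "L (A n) \<in> sets N" for n by (intro L_in A)
  have U: "(\<Union>n. A n) \<in> sets M" by auto
  have "L (\<Union>n. A n) - (\<Union>n. L (A n)) \<in> sets N"
    using L_in[OF U] by auto
  then obtain C where C: "C \<in> sets M"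
    "AE y in N. y \<in> L C \<longleftrightarrow> y \<in> L (\<Union>n. A n) - (\<Union>n. L (A n))"
    using L_surj by blast
  have "AE x in M. x \<in> C \<longrightarrow> x \<notin> A n" for n
    using C(2) by (subst L_AE_disjoint_iff[symmetric]) (use A C(1) in auto)
  then have "AE x in M. \<forall>n. x \<in> C \<longrightarrow> x \<notin> A n"
    unfolding AE_all_countable by blast
  then have "AE x in M. x \<in> C \<longrightarrow> x \<notin> (\<Union>n. A n)"
    by eventually_elim auto
  then have 1: "AE y in N. y \<in> L C \<longrightarrow> y \<notin> L (\<Union>n. A n)"
    using C(1) U by (subst L_AE_disjoint_iff)
  have "AE y in N. y \<in> L (A n) \<longrightarrow> y \<in> L (\<Union>n. A n)" for n
    using U by (intro L_mono) auto
  then have "AE y in N. \<forall>n. y \<in> L (A n) \<longrightarrow> y \<in> L (\<Union>n. A n)"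
    unfolding AE_all_countable by blast
  with 1 C(2) show ?thesis by eventually_elim auto
qed

text \<open>The graph of the map induced by \<open>L\<close>, described through preimages of Borel sets, so that it is
  visibly stable under post-composition with Borel functions.\<close>

definition rel :: "('a \<Rightarrow> 'c::topological_space) \<Rightarrow> ('b \<Rightarrow> 'c) \<Rightarrow> bool" where
  "rel f g \<longleftrightarrow> f \<in> borel_measurable M \<and> g \<in> borel_measurable N \<and>
    (\<forall>U\<in>sets borel. AE y in N. y \<in> L (f -` U \<inter> space M) \<longleftrightarrow> g y \<in> U)"

lemma relD:
  assumes "rel f g"
  shows "f \<in> borel_measurable M" "g \<in> borel_measurable N"
    "U \<in> sets borel \<Longrightarrow> AE y in N. y \<in> L (f -` U \<inter> space M) \<longleftrightarrow> g y \<in> U"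
  using assms by (auto simp: rel_def)

text \<open>The Borel sets whose preimages correspond form a sigma-algebra: \<open>L_diff\<close>
  and \<open>L_space\<close> give complements, \<open>L_UN\<close> gives countable unions. Checking
  a generator therefore suffices.\<close>

lemma rel_generatorI:
  fixes f :: "'a \<Rightarrow> 'c::topological_space"
  assumes [measurable]: "f \<in> borel_measurable M" "g \<in> borel_measurable N"
    and borel_eq: "sets (borel :: 'c measure) = sigma_sets UNIV G"
    and G: "\<And>U. U \<in> G \<Longrightarrow> AE y in N. y \<in> L (f -` U \<inter> space M) \<longleftrightarrow> g y \<in> U"
  shows "rel f g"
  unfolding rel_def
proof (intro conjI ballI assms(1,2))
  fix U :: "'c set" assume "U \<in> sets borel"
  then have "U \<in> sigma_sets UNIV G" using borel_eq by simp
  then show "AE y in N. y \<in> L (f -` U \<inter> space M) \<longleftrightarrow> g y \<in> U"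
  proof induction
    case (Basic U)
    then show ?case by (rule G)
  next
    case Empty
    then show ?case using L_empty by simp
  next
    case (Compl U)
    then have U: "U \<in> sets borel" using borel_eq by simp
    have *: "f -` (UNIV - U) \<inter> space M = space M - (f -` U \<inter> space M)" by auto
    have "AE y in N. y \<in> L (space M - (f -` U \<inter> space M)) \<longleftrightarrow>
        y \<in> L (space M) \<and> y \<notin> L (f -` U \<inter> space M)"
      using U by (intro L_diff) auto
    with Compl.IH L_space show ?case unfolding * by eventually_elim auto
  next
    case (Union U)
    then have U: "U n \<in> sets borel" for n using borel_eq by simp
    have *: "f -` (\<Union>n. U n) \<inter> space M = (\<Union>n. f -` U n \<inter> space M)" by auto
    have 1: "AE y in N. y \<in> L (\<Union>n. f -` U n \<inter> space M) \<longleftrightarrow> (\<exists>n. y \<in> L (f -` U n \<inter> space M))"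
      using U by (intro L_UN) auto
    have "AE y in N. \<forall>n. y \<in> L (f -` U n \<inter> space M) \<longleftrightarrow> g y \<in> U n"
      using Union.IH by (simp add: AE_all_countable)
    with 1 show ?case unfolding * by eventually_elim auto
  qed
qed

lemma rel_compose:
  assumes "rel f g" "h \<in> borel_measurable borel"
  shows "rel (\<lambda>x. h (f x)) (\<lambda>y. h (g y))"
  unfolding rel_def
proof (intro conjI ballI)
  show "(\<lambda>x. h (f x)) \<in> borel_measurable M" "(\<lambda>y. h (g y)) \<in> borel_measurable N"
    using relD(1,2)[OF assms(1)] assms(2) by simp_all
  fix U :: "'d set" assume U: "U \<in> sets borel"
  have "h -` U \<in> sets borel" using measurable_sets[OF assms(2) U] by simp
  from relD(3)[OF assms(1) this]
  show "AE y in N. y \<in> L ((\<lambda>x. h (f x)) -` U \<inter> space M) \<longleftrightarrow> h (g y) \<in> U"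
    by (simp add: vimage_def)
qed

text \<open>Second countability makes the measurable rectangles generate the Borel sets of the
  product, and the preimage of a rectangle is an intersection. Through this lemma all binary
  operations become instances of post-composition.\<close>

lemma rel_Pair:
  fixes f1 :: "'a \<Rightarrow> 'c::second_countable_topology" and f2 :: "'a \<Rightarrow> 'd::second_countable_topology"
  assumes 1: "rel f1 g1" and 2: "rel f2 g2"
  shows "rel (\<lambda>x. (f1 x, f2 x)) (\<lambda>y. (g1 y, g2 y))"
proof (rule rel_generatorI)
  note [measurable] = relD(1,2)[OF 1] relD(1,2)[OF 2]
  show "(\<lambda>x. (f1 x, f2 x)) \<in> borel_measurable M" "(\<lambda>y. (g1 y, g2 y)) \<in> borel_measurable N"
    by measurable
  show "sets (borel :: ('c \<times> 'd) measure) =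
      sigma_sets UNIV {a \<times> b | a b. a \<in> sets borel \<and> b \<in> sets borel}"
    using sets_pair_measure[of "borel :: 'c measure" "borel :: 'd measure"]
    unfolding borel_prod by simp
  fix U :: "('c \<times> 'd) set" assume "U \<in> {a \<times> b | a b. a \<in> sets borel \<and> b \<in> sets borel}"
  then obtain a b where U: "U = a \<times> b" "a \<in> sets borel" "b \<in> sets borel" by auto
  have *: "(\<lambda>x. (f1 x, f2 x)) -` U \<inter> space M = (f1 -` a \<inter> space M) \<inter> (f2 -` b \<inter> space M)"
    by (auto simp: U)
  have "AE y in N. y \<in> L ((f1 -` a \<inter> space M) \<inter> (f2 -` b \<inter> space M)) \<longleftrightarrow>
      y \<in> L (f1 -` a \<inter> space M) \<and> y \<in> L (f2 -` b \<inter> space M)"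
    using U by (intro L_Int) auto
  with relD(3)[OF 1 U(2)] relD(3)[OF 2 U(3)]
  show "AE y in N. y \<in> L ((\<lambda>x. (f1 x, f2 x)) -` U \<inter> space M) \<longleftrightarrow> (g1 y, g2 y) \<in> U"
    unfolding * by eventually_elim (auto simp: U)
qed

lemma rel_compose2:
  fixes f1 :: "'a \<Rightarrow> 'c::second_countable_topology" and f2 :: "'a \<Rightarrow> 'd::second_countable_topology"
  assumes "rel f1 g1" "rel f2 g2" "(\<lambda>p. h (fst p) (snd p)) \<in> borel_measurable borel"
  shows "rel (\<lambda>x. h (f1 x) (f2 x)) (\<lambda>y. h (g1 y) (g2 y))"
  using rel_compose[OF rel_Pair[OF assms(1,2)] assms(3)] by simp

text \<open>The set where \<open>P\<close> fails is the preimage of a Borel set, and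
  \<open>L\<close> both preserves and reflects null sets.\<close>

lemma rel_AE_iff:
  assumes "rel f g" "{z. P z} \<in> sets borel"
  shows "(AE x in M. P (f x)) \<longleftrightarrow> (AE y in N. P (g y))"
proof -
  note [measurable] = relD(1,2)[OF assms(1)]
  have c: "{z. \<not> P z} \<in> sets borel"
    using sets.compl_sets[OF assms(2)] by (simp add: Collect_neg_eq Compl_eq_Diff_UNIV)
  have "(AE x in M. P (f x)) \<longleftrightarrow> (AE x in M. x \<notin> f -` {z. \<not> P z} \<inter> space M)"
    by (intro AE_cong) auto
  also have "\<dots> \<longleftrightarrow> (AE y in N. y \<notin> L (f -` {z. \<not> P z} \<inter> space M))"
    using c by (intro L_null[symmetric] measurable_sets[OF relD(1)[OF assms(1)]])
  also have "\<dots> \<longleftrightarrow> (AE y in N. P (g y))"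
    by (rule eventually_subst[OF eventually_mono[OF relD(3)[OF assms(1) c]]]) auto
  finally show ?thesis .
qed

text \<open>The diagonal of a Hausdorff space is closed. Read from left to right this makes the
  induced map well defined, from right to left injective.\<close>

lemma rel_AE_eq_iff:
  fixes f1 f2 :: "'a \<Rightarrow> 'c::{second_countable_topology, t2_space}"
  assumes "rel f1 g1" "rel f2 g2"
  shows "(AE x in M. f1 x = f2 x) \<longleftrightarrow> (AE y in N. g1 y = g2 y)"
proof -
  have "closed {z :: 'c \<times> 'c. fst z = snd z}"
    by (intro closed_Collect_eq continuous_intros)
  then have "{z :: 'c \<times> 'c. fst z = snd z} \<in> sets borel" by (rule borel_closed)
  from rel_AE_iff[OF rel_Pair[OF assms] this] show ?thesis by simp
qed

lemma rel_AE_cong: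
  assumes "rel f g" "f' \<in> borel_measurable M" "g' \<in> borel_measurable N"
    "AE x in M. f x = f' x" "AE y in N. g y = g' y"
  shows "rel f' g'"
  unfolding rel_def
proof (intro conjI ballI assms(2,3))
  fix U :: "'c set" assume U: "U \<in> sets borel"
  have "AE y in N. y \<in> L (f -` U \<inter> space M) \<longleftrightarrow> y \<in> L (f' -` U \<inter> space M)"
    using assms(2,4) relD(1)[OF assms(1)] U by (intro L_AE_cong) (auto intro: measurable_sets)
  with relD(3)[OF assms(1) U] assms(5)
  show "AE y in N. y \<in> L (f' -` U \<inter> space M) \<longleftrightarrow> g' y \<in> U"
    by eventually_elim auto
qed

lemma rel_indicator:
  assumes "A \<in> sets M"
  shows "rel (indicator A) (indicator (L A) :: 'b \<Rightarrow> 'c::{zero_neq_one, second_countable_topology, t2_space})"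
  unfolding rel_def
proof (intro conjI ballI)
  fix U :: "'c set"
  have "(indicator A :: 'a \<Rightarrow> 'c) -` U \<inter> space M =
      (if 1 \<in> U then if 0 \<in> U then space M else A else if 0 \<in> U then space M - A else {})"
    using sets.sets_into_space[OF assms] by (auto simp: indicator_def of_bool_def split: if_splits)
  moreover have "AE y in N. y \<in> L (space M - A) \<longleftrightarrow> y \<in> L (space M) \<and> y \<notin> L A"
    using assms by (intro L_diff) auto
  ultimately show "AE y in N. y \<in> L (indicator A -` U \<inter> space M) \<longleftrightarrow>
      (indicator (L A) y :: 'c) \<in> U"
    using L_space L_empty by (auto simp: indicator_def)
qed (use assms L_in in \<open>auto intro!: borel_measurable_indicator\<close>)

text \<open>The image function is rebuilt from the transported superlevel sets, as the supremum over
  rational \<open>q\<close> of \<open>q\<close> times the indicator of \<open>L {r > q}\<close>.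
  Only countably many sets are involved, so \<open>L_UN\<close> controls its superlevel
  sets.\<close>

lemma rel_unit_interval_total:
  fixes r :: "'a \<Rightarrow> real"
  assumes [measurable]: "r \<in> borel_measurable M" and r: "\<And>x. 0 \<le> r x \<and> r x \<le> 1"
  shows "\<exists>g. rel r g \<and> (\<forall>y. 0 \<le> g y \<and> g y \<le> 1)"
proof -
  define Q :: "real set" where "Q = \<rat> \<inter> {0..1}"
  define A where "A q = {x\<in>space M. q < r x}" for q
  have A [measurable]: "A q \<in> sets M" for q unfolding A_def by measurable
  have LA: "L (A q) \<in> sets N" for q by (intro L_in A)
  define g where "g y = (SUP q\<in>Q. q * indicator (L (A q)) y :: real)" for y
  have Q: "countable Q" "0 \<in> Q" "Q \<noteq> {}"
    unfolding Q_def by (auto intro: countable_Int1 countable_rat)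
  have bdd: "bdd_above ((\<lambda>q. q * indicator (L (A q)) y :: real) ` Q)" for y
    by (rule bdd_aboveI[of _ 1]) (auto simp: Q_def indicator_def)
  have less_g: "t < g y \<longleftrightarrow> (\<exists>q\<in>Q. t < q * indicator (L (A q)) y)" for t y
    unfolding g_def using Q(3) bdd by (rule less_cSUP_iff)
  have g01: "0 \<le> g y \<and> g y \<le> 1" for y
  proof
    have "0 * indicator (L (A 0)) y \<le> g y"
      unfolding g_def by (rule cSUP_upper[OF Q(2) bdd])
    then show "0 \<le> g y" by simp
    show "g y \<le> 1"
      unfolding g_def by (rule cSUP_least[OF Q(3)]) (auto simp: Q_def indicator_def)
  qed
  have "rel r g"
  proof (rule rel_generatorI)
    show "r \<in> borel_measurable M" by fact
    show "g \<in> borel_measurable N"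
      unfolding g_def[abs_def] using Q LA bdd
      by (intro borel_measurable_cSUP) auto
    show "sets (borel :: real measure) = sigma_sets UNIV (range greaterThan)"
      by (subst borel_Ioi) simp
    fix U :: "real set" assume "U \<in> range greaterThan"
    then obtain t where U: "U = {t<..}" by auto
    have rU: "r -` U \<inter> space M = A t" by (auto simp: U A_def)
    show "AE y in N. y \<in> L (r -` U \<inter> space M) \<longleftrightarrow> g y \<in> U"
    proof (cases "0 \<le> t")
      case False
      have "A t = space M" using False r by (auto simp: A_def intro: less_le_trans[of _ 0])
      moreover have "g y \<in> U" for y using g01[of y] False by (auto simp: U)
      ultimately show ?thesis using L_space by (simp add: rU)
    next
      case True
      \<comment> \<open>A rational between \<open>t\<close> and \<open>r x\<close> lies in
        \<open>Q\<close> because \<open>t\<close> is nonnegative and \<open>r x\<close> is at most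
        1.\<close>
      have eq: "A t = (\<Union>q\<in>Q\<inter>{t<..}. A q)"
      proof (rule set_eqI)
        fix x
        have "\<exists>q\<in>Q. t < q \<and> q < r x" if less: "t < r x"
        proof -
          obtain q where "t < q" "q < r x" "q \<in> \<rat>" using Rats_dense_in_real[OF less] by blast
          then show ?thesis using True r[of x] by (intro bexI[of _ q]) (auto simp: Q_def)
        qed
        then show "x \<in> A t \<longleftrightarrow> x \<in> (\<Union>q\<in>Q\<inter>{t<..}. A q)"
          unfolding A_def by fastforce
      qed
      \<comment> \<open>The index set is empty when \<open>t\<close> is at least 1 and then cannot
        be enumerated by the naturals, so that case is separate.\<close>
      have UN: "AE y in N. y \<in> L (A t) \<longleftrightarrow> (\<exists>q\<in>Q\<inter>{t<..}. y \<in> L (A q))"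
      proof (cases "Q \<inter> {t<..} = {}")
        case True
        then have "A t = {}" using eq by auto
        then show ?thesis using L_empty True by auto
      next
        case False
        define e where "e = from_nat_into (Q \<inter> {t<..})"
        have e: "range e = Q \<inter> {t<..}"
          unfolding e_def using Q(1) False by (intro range_from_nat_into) auto
        then have eq': "A t = (\<Union>n. A (e n))" unfolding eq e[symmetric] by blast
        have "AE y in N. y \<in> L (A t) \<longleftrightarrow> (\<exists>n. y \<in> L (A (e n)))"
          unfolding eq' by (intro L_UN) auto
        then show ?thesis unfolding e[symmetric] by auto
      qed
      \<comment> \<open>Since \<open>t\<close> is nonnegative, a term of the supremum exceeds
        \<open>t\<close> only where its indicator is 1.\<close>
      have "g y \<in> U \<longleftrightarrow> (\<exists>q\<in>Q\<inter>{t<..}. y \<in> L (A q))" for y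
        using True by (auto simp: U less_g indicator_def split: if_splits)
      then show ?thesis using UN by (simp add: rU)
    qed
  qed
  with g01 show ?thesis by blast
qed

lemma rel_bounded_real_total:
  fixes f :: "'a \<Rightarrow> real"
  assumes [measurable]: "f \<in> borel_measurable M" and f: "\<And>x. x \<in> space M \<Longrightarrow> \<bar>f x\<bar> \<le> c"
  shows "\<exists>g. rel f g \<and> bounded (range g)"
proof -
  \<comment> \<open>The maximum with 1 keeps the scaling factor positive; \<open>c\<close> itself
    may be zero, or negative when the space is empty.\<close>
  define c' where "c' = max c 1"
  have c': "c' > 0" "\<And>x. x \<in> space M \<Longrightarrow> \<bar>f x\<bar> \<le> c'" using f by (fastforce simp: c'_def)+
  \<comment> \<open>An affine map takes \<open>[-c', c']\<close> onto \<open>[0, 1]\<close>. The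
    truncation acts only outside \<open>space M\<close>, where \<open>f\<close> is not controlled
    although \<open>rel_unit_interval_total\<close> wants its bounds everywhere.\<close>
  define r where "r x = max 0 (min 1 ((f x + c') / (2 * c')))" for x
  have [measurable]: "r \<in> borel_measurable M" unfolding r_def[abs_def] by measurable
  have "0 \<le> r x \<and> r x \<le> 1" for x by (auto simp: r_def)
  then obtain g where g: "rel r g" "\<And>y. 0 \<le> g y \<and> g y \<le> 1"
    using rel_unit_interval_total[of r] by auto
  have fr: "f x = 2 * c' * r x - c'" if "x \<in> space M" for x
    using c'(1) c'(2)[OF that] by (auto simp: r_def max_def min_def field_simps)
  have "rel (\<lambda>x. 2 * c' * r x - c') (\<lambda>y. 2 * c' * g y - c')"
    by (rule rel_compose[OF g(1)]) measurable
  then have "rel f (\<lambda>y. 2 * c' * g y - c')"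
    by (rule rel_AE_cong) (use fr relD(2)[OF g(1)] in auto)
  moreover have "bounded (range (\<lambda>y. 2 * c' * g y - c'))"
  proof (rule boundedI)
    fix z assume "z \<in> range (\<lambda>y. 2 * c' * g y - c')"
    then obtain y where z: "z = 2 * c' * g y - c'" by auto
    have "0 \<le> 2 * c' * g y" "2 * c' * g y \<le> 2 * c' * 1"
      using g(2)[of y] c'(1) by (auto intro!: mult_left_mono)
    then show "norm z \<le> c'" by (simp add: z abs_le_iff)
  qed
  ultimately show ?thesis by blast
qed

lemma rel_total:
  assumes "f \<in> Minf M"
  shows "\<exists>g\<in>Minf N. rel f g"
proof -
  have [measurable]: "f \<in> borel_measurable M" using assms by (simp add: Minf_def)
  obtain c where c: "\<And>x. x \<in> space M \<Longrightarrow> cmod (f x) \<le> c"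
    using assms by (auto simp: Minf_def bounded_iff)
  have "\<bar>Re (f x)\<bar> \<le> c" "\<bar>Im (f x)\<bar> \<le> c" if "x \<in> space M" for x
    using c[OF that] abs_Re_le_cmod[of "f x"] abs_Im_le_cmod[of "f x"] by auto
  then obtain u v where u: "rel (\<lambda>x. Re (f x)) u" "bounded (range u)"
    and v: "rel (\<lambda>x. Im (f x)) v" "bounded (range v)"
    using rel_bounded_real_total[of "\<lambda>x. Re (f x)" c] rel_bounded_real_total[of "\<lambda>x. Im (f x)" c]
    by (auto simp: borel_measurable_complex_iff[THEN iffD1])
  define g where "g y = Complex (u y) (v y)" for y
  have "rel (\<lambda>x. Complex (Re (f x)) (Im (f x))) g"
    unfolding g_def[abs_def]
    by (intro rel_compose2[OF u(1) v(1)] borel_measurable_continuous_onI continuous_intros)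
  then have fg: "rel f g" by simp
  obtain a b where ab: "\<And>y. \<bar>u y\<bar> \<le> a" "\<And>y. \<bar>v y\<bar> \<le> b"
    using u(2) v(2) by (auto simp: bounded_iff)
  have "cmod (g y) \<le> a + b" for y
    using cmod_le[of "g y"] ab(1)[of y] ab(2)[of y] by (simp add: g_def)
  then have "bounded (g ` space N)" by (auto simp: bounded_iff)
  with fg relD(2)[OF fg] show ?thesis by (auto simp: Minf_def)
qed

text \<open>\<open>L\<close> has an inverse up to null sets, and its graph is the converse of \<open>rel\<close>.\<close>

lemma rel_surj:
  assumes "g \<in> Minf N"
  shows "\<exists>f\<in>Minf M. rel f g"
proof -
  \<comment> \<open>\<open>K\<close> chooses a preimage of each measurable set under
    \<open>L\<close>, unique up to null sets.\<close>
  define K where "K B = (SOME A. A \<in> sets M \<and> (AE y in N. y \<in> L A \<longleftrightarrow> y \<in> B))" for B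
  have K: "K B \<in> sets M" "AE y in N. y \<in> L (K B) \<longleftrightarrow> y \<in> B" if "B \<in> sets N" for B
    using someI_ex[OF L_surj[OF that, unfolded Bex_def]] unfolding K_def by auto
  \<comment> \<open>Each property of \<open>K\<close> can be tested after applying \<open>L\<close>,
    which reflects null sets and almost equality and turns \<open>K B\<close> back into
    \<open>B\<close>.\<close>
  interpret K: regular_iso N M K
  proof
    fix B assume B: "B \<in> sets N"
    show "K B \<in> sets M" using B by (rule K)
    have "(AE x in M. x \<notin> K B) \<longleftrightarrow> (AE y in N. y \<notin> L (K B))"
      using L_null[OF K(1)[OF B]] by simp
    also have "\<dots> \<longleftrightarrow> (AE y in N. y \<notin> B)"
      by (rule eventually_subst[OF eventually_mono[OF K(2)[OF B]]]) auto
    finally show "(AE x in M. x \<notin> K B) \<longleftrightarrow> (AE y in N. y \<notin> B)" .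
    fix C assume C: "C \<in> sets N"
    have BC: "B - C \<in> sets N" using B C by auto
    have "AE y in N. y \<in> L (K B - K C) \<longleftrightarrow> y \<in> L (K (B - C))"
      using L_diff[OF K(1)[OF B] K(1)[OF C]] K(2)[OF B] K(2)[OF C] K(2)[OF BC]
      by eventually_elim auto
    then have "AE x in M. x \<in> K B - K C \<longleftrightarrow> x \<in> K (B - C)"
      by (rule L_AE_eq_iff[OF sets.Diff[OF K(1)[OF B] K(1)[OF C]] K(1)[OF BC], THEN iffD1])
    then show "AE x in M. x \<in> K (B - C) \<longleftrightarrow> x \<in> K B \<and> x \<notin> K C"
      by eventually_elim auto
  next
    fix A assume A: "A \<in> sets M"
    note LA = L_in[OF A]
    have "AE x in M. x \<in> K (L A) \<longleftrightarrow> x \<in> A"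
      by (rule L_AE_eq_iff[OF K(1)[OF LA] A, THEN iffD1, OF K(2)[OF LA]])
    then show "\<exists>B\<in>sets N. AE x in M. x \<in> K B \<longleftrightarrow> x \<in> A"
      using LA by (intro bexI[of _ "L A"]) auto
  qed
  obtain f where f: "f \<in> Minf M" "K.rel g f" using K.rel_total[OF assms] by auto
  have "rel f g"
    unfolding rel_def
  proof (intro conjI ballI K.relD(1,2)[OF f(2)])
    fix U :: "complex set" assume U: "U \<in> sets borel"
    note [measurable] = K.relD(1,2)[OF f(2)]
    have B: "g -` U \<inter> space N \<in> sets N" using U by measurable
    \<comment> \<open>Applying \<open>L\<close> to the relation between \<open>g\<close> and
      \<open>f\<close> cancels \<open>K\<close> and gives the relation between \<open>f\<close> and
      \<open>g\<close>.\<close>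
    have "AE x in M. x \<in> f -` U \<inter> space M \<longleftrightarrow> x \<in> K (g -` U \<inter> space N)"
      using K.relD(3)[OF f(2) U] AE_space[of M] by eventually_elim auto
    then have "AE y in N. y \<in> L (f -` U \<inter> space M) \<longleftrightarrow> y \<in> L (K (g -` U \<inter> space N))"
      using U K(1)[OF B] by (intro L_AE_cong) auto
    with K(2)[OF B] AE_space[of N]
    show "AE y in N. y \<in> L (f -` U \<inter> space M) \<longleftrightarrow> g y \<in> U" by eventually_elim auto
  qed
  with f show ?thesis by blast
qed

end

section \<open>The induced map on bounded functions\<close>

text \<open>Boundedness keeps the essential supremum below infinity. It is minus infinity on a null
  space, where the norm is 0; nonnegativity of \<open>s\<close> makes both sides true there.\<close>

lemma Linf_norm_le_iff:
  assumes f: "f \<in> Minf M" and s: "0 \<le> s"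
  shows "Linf_norm M (Linf_class M f) \<le> s \<longleftrightarrow> (AE x in M. cmod (f x) \<le> s)"
proof -
  let ?E = "esssup M (\<lambda>x. ereal (cmod (f x)))"
  have [measurable]: "f \<in> borel_measurable M" using f by (simp add: Minf_def)
  obtain c where c: "\<And>x. x \<in> space M \<Longrightarrow> cmod (f x) \<le> c"
    using f by (auto simp: Minf_def bounded_iff)
  have le: "?E \<le> ereal t" if "AE x in M. cmod (f x) \<le> t" for t
    using that by (intro esssup_I) auto
  have "?E \<le> ereal c" using c by (intro le) auto
  then have "?E \<noteq> \<infinity>" by auto
  then have "real_of_ereal ?E \<le> s \<longleftrightarrow> ?E \<le> ereal s"
    using s by (cases ?E) auto
  also have "\<dots> \<longleftrightarrow> (AE x in M. cmod (f x) \<le> s)"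
  proof
    assume "?E \<le> ereal s"
    from esssup_AE[of "\<lambda>x. ereal (cmod (f x))" M]
    show "AE x in M. cmod (f x) \<le> s"
      by eventually_elim (use \<open>?E \<le> ereal s\<close> order_trans ereal_less_eq(3) in blast)
  qed (rule le)
  finally show ?thesis using Linf_norm_class[OF f] by simp
qed

section \<open>Density of simple functions and uniqueness of the induced map\<close>

lemma LinfE:
  assumes "F \<in> Linf M"
  obtains f where "f \<in> Minf M" "F = Linf_class M f"
  using assms by (auto simp: Linf_eq_image)

lemma Linf_class_eq_iff:
  assumes "f \<in> Minf M" "g \<in> Minf M"
  shows "Linf_class M f = Linf_class M g \<longleftrightarrow> (AE x in M. f x = g x)"
  using Linf_class_eqI[OF assms] Linf_class_iff[OF assms(1), of g] Linf_class_self[OF assms(2)]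
  by auto

text \<open>Real and imaginary parts are rounded down to a grid of mesh \<open>e / 2\<close>. A
  bounded function meets finitely many grid points, and the two rounding errors add up to at most
  \<open>e\<close>.\<close>

lemma simple_function_approx:
  assumes f: "f \<in> Minf M" and e: "e > 0"
  shows "\<exists>S A. finite S \<and> (\<forall>v\<in>S. A v \<in> sets M) \<and>
    (\<forall>x\<in>space M. cmod ((\<Sum>v\<in>S. v * indicator (A v) x) - f x) \<le> e)"
proof -
  have [measurable]: "f \<in> borel_measurable M" using f by (simp add: Minf_def)
  obtain c where c: "\<And>x. x \<in> space M \<Longrightarrow> cmod (f x) \<le> c"
    using f by (auto simp: Minf_def bounded_iff)
  define d where "d = e / 2"
  have d: "d > 0" using e by (simp add: d_def)
  define k where "k t = \<lfloor>t / d\<rfloor>" for t :: real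
  define h where "h z = Complex (d * of_int (k (Re z))) (d * of_int (k (Im z)))" for z
  define S where "S = h ` f ` space M"
  define A where "A v = {x\<in>space M. h (f x) = v}" for v
  have hf: "(\<lambda>x. h (f x)) \<in> borel_measurable M"
    unfolding h_def k_def by (subst borel_measurable_complex_iff) simp
  have "A v \<in> sets M" for v
    unfolding A_def using measurable_sets[OF hf, of "{v}"]
    by (simp add: vimage_def Int_def conj_commute)
  moreover have "finite S"
  proof (rule finite_subset)
    \<comment> \<open>The extra unit at both ends absorbs the loss from taking the floor.\<close>
    let ?J = "{-\<lceil>c / d\<rceil> - 1..\<lceil>c / d\<rceil> + 1}"
    show "S \<subseteq> (\<lambda>(a, b). Complex (d * of_int a) (d * of_int b)) ` (?J \<times> ?J)"
    proof
      fix v assume "v \<in> S"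
      then obtain x where x: "x \<in> space M" "v = h (f x)" by (auto simp: S_def)
      have J: "k t \<in> ?J" if "\<bar>t\<bar> \<le> c" for t
      proof -
        have "t / d \<le> c / d" "- (c / d) \<le> t / d"
          using that d by (auto simp: divide_right_mono field_simps abs_le_iff)
        then show ?thesis unfolding k_def by simp linarith
      qed
      have "k (Re (f x)) \<in> ?J" "k (Im (f x)) \<in> ?J"
        using c[OF x(1)] abs_Re_le_cmod[of "f x"] abs_Im_le_cmod[of "f x"] by (intro J; linarith)+
      then show "v \<in> (\<lambda>(a, b). Complex (d * of_int a) (d * of_int b)) ` (?J \<times> ?J)"
        by (intro image_eqI[of _ _ "(k (Re (f x)), k (Im (f x)))"]) (simp_all add: x h_def)
    qed
  qed simp
  moreover have "cmod ((\<Sum>v\<in>S. v * indicator (A v) x) - f x) \<le> e" if x: "x \<in> space M" for x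
  proof -
    have "(\<Sum>v\<in>S. v * indicator (A v) x) = (\<Sum>v\<in>S. if v = h (f x) then v else 0)"
      using x by (intro sum.cong) (auto simp: A_def indicator_def)
    also have "\<dots> = h (f x)" using \<open>finite S\<close> x by (simp add: S_def)
    finally have "(\<Sum>v\<in>S. v * indicator (A v) x) = h (f x)" .
    moreover have "\<bar>d * of_int (k t) - t\<bar> \<le> d" for t
    proof -
      have "of_int (k t) \<le> t / d" "t / d \<le> of_int (k t) + 1" unfolding k_def by linarith+
      then show ?thesis using d by (simp add: field_simps abs_le_iff)
    qed
    then have "cmod (h (f x) - f x) \<le> d + d"
      by (intro order_trans[OF cmod_le] add_mono) (simp_all add: h_def)
    ultimately show ?thesis by (simp add: d_def)
  qed
  ultimately show ?thesis by blast
qed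

lemma Linf_linear_eq_on_simple:
  assumes "Linf_linear M N T1" "Linf_linear M N T2"
    and ind: "\<And>A. A \<in> sets M \<Longrightarrow> T1 (Linf_class M (indicator A)) = T2 (Linf_class M (indicator A))"
    and "finite S" "\<And>v. v \<in> S \<Longrightarrow> A v \<in> sets M"
  shows "(\<lambda>x. \<Sum>v\<in>S. c v * indicator (A v) x) \<in> Minf M \<and>
    T1 (Linf_class M (\<lambda>x. \<Sum>v\<in>S. c v * indicator (A v) x)) =
    T2 (Linf_class M (\<lambda>x. \<Sum>v\<in>S. c v * indicator (A v) x))"
  using assms(4,5)
proof (induction S rule: finite_induct)
  case empty
  \<comment> \<open>The empty sum is rewritten as 0 times an indicator, so that homogeneity and
    \<open>ind\<close> settle it.\<close>
  have I: "indicator {} \<in> Minf M" by (rule Minf_indicator) simp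
  have "T (Linf_class M (\<lambda>x. 0)) = Linf_scale N 0 (T (Linf_class M (indicator {})))"
    if "Linf_linear M N T" for T
    using that Linf_scale_class[OF I, of 0] Linf_class_in_Linf[OF I] unfolding Linf_linear_def
    by (metis (no_types, lifting) mult_zero_left ext)
  from this[OF assms(1)] this[OF assms(2)] ind[of "{}"] show ?case by (simp add: Minf_const)
next
  case (insert v S)
  let ?s = "\<lambda>x. \<Sum>v\<in>S. c v * indicator (A v) x"
  have s: "?s \<in> Minf M" "T1 (Linf_class M ?s) = T2 (Linf_class M ?s)" using insert by auto
  have I: "indicator (A v) \<in> Minf M" using insert.prems by (intro Minf_indicator) simp
  have cI: "(\<lambda>x. c v * indicator (A v) x) \<in> Minf M" by (rule Minf_mult[OF Minf_const I])
  have eq: "T (Linf_class M (\<lambda>x. c v * indicator (A v) x + ?s x)) =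
      Linf_add N (Linf_scale N (c v) (T (Linf_class M (indicator (A v))))) (T (Linf_class M ?s))"
    if "Linf_linear M N T" for T
  proof -
    have "Linf_class M (\<lambda>x. c v * indicator (A v) x + ?s x) =
        Linf_add M (Linf_scale M (c v) (Linf_class M (indicator (A v)))) (Linf_class M ?s)"
      using Linf_add_class[OF cI s(1)] Linf_scale_class[OF I, of "c v"] by simp
    moreover have "Linf_scale M (c v) (Linf_class M (indicator (A v))) \<in> Linf M"
      unfolding Linf_scale_class[OF I] by (rule Linf_class_in_Linf[OF cI])
    ultimately show ?thesis
      using that Linf_class_in_Linf[OF I] Linf_class_in_Linf[OF s(1)]
      unfolding Linf_linear_def by simp
  qed
  show ?case
    unfolding sum.insert[OF insert.hyps(1,2)] eq[OF assms(1)] eq[OF assms(2)] s(2)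
      ind[OF insert.prems[OF insertI1]]
    by (rule conjI[OF Minf_add[OF cI s(1)] refl])
qed

text \<open>This is the uniqueness behind the \<open>THE\<close> in \<open>Linf_hat\<close>. A
  simple function close to \<open>F\<close> has the same image under both maps, and by continuity
  this image is close to both \<open>T1 F\<close> and \<open>T2 F\<close>.\<close>

lemma Linf_map_eqI:
  assumes T1: "T1 \<in> Linf M \<rightarrow>\<^sub>E Linf N" "Linf_linear M N T1" "Linf_norm_continuous M N T1"
    and T2: "T2 \<in> Linf M \<rightarrow>\<^sub>E Linf N" "Linf_linear M N T2" "Linf_norm_continuous M N T2"
    and ind: "\<And>A. A \<in> sets M \<Longrightarrow> T1 (Linf_class M (indicator A)) = T2 (Linf_class M (indicator A))"
  shows "T1 = T2"
proof (rule PiE_ext[OF T1(1) T2(1)])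
  fix F assume F: "F \<in> Linf M"
  then obtain f where f: "f \<in> Minf M" "F = Linf_class M f" by (rule LinfE)
  obtain g1 where g1: "g1 \<in> Minf N" "T1 F = Linf_class N g1"
    using PiE_mem[OF T1(1) F] by (rule LinfE)
  obtain g2 where g2: "g2 \<in> Minf N" "T2 F = Linf_class N g2"
    using PiE_mem[OF T2(1) F] by (rule LinfE)
  have "AE y in N. cmod (g1 y - g2 y) \<le> 2 * e" if e: "e > 0" for e :: real
  proof -
    obtain d1 where d1: "d1 > 0" "\<And>G. G \<in> Linf M \<Longrightarrow> Linf_norm M (Linf_diff M G F) < d1 \<Longrightarrow>
        Linf_norm N (Linf_diff N (T1 G) (T1 F)) < e"
      using T1(3) F e unfolding Linf_norm_continuous_def by blast
    obtain d2 where d2: "d2 > 0" "\<And>G. G \<in> Linf M \<Longrightarrow> Linf_norm M (Linf_diff M G F) < d2 \<Longrightarrow>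
        Linf_norm N (Linf_diff N (T2 G) (T2 F)) < e"
      using T2(3) F e unfolding Linf_norm_continuous_def by blast
    \<comment> \<open>Halving turns the weak bound of the approximation into the strict one that
      continuity asks for.\<close>
    define d where "d = min d1 d2 / 2"
    have d: "d > 0" "d < d1" "d < d2" using d1(1) d2(1) by (auto simp: d_def min_def)
    obtain S A where SA: "finite S" "\<And>v. v \<in> S \<Longrightarrow> A v \<in> sets M"
      "\<And>x. x \<in> space M \<Longrightarrow> cmod ((\<Sum>v\<in>S. v * indicator (A v) x) - f x) \<le> d"
      using simple_function_approx[OF f(1) d(1)] by blast
    define s where "s x = (\<Sum>v\<in>S. v * indicator (A v) x)" for x
    have s: "s \<in> Minf M" "T1 (Linf_class M s) = T2 (Linf_class M s)"
      using Linf_linear_eq_on_simple[OF T1(2) T2(2) ind SA(1,2), where c = "\<lambda>v. v"]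
      unfolding s_def[abs_def] by auto
    have G: "Linf_class M s \<in> Linf M" by (rule Linf_class_in_Linf[OF s(1)])
    obtain h where h: "h \<in> Minf N" "T1 (Linf_class M s) = Linf_class N h"
      using PiE_mem[OF T1(1) G] by (rule LinfE)
    have "Linf_norm M (Linf_diff M (Linf_class M s) F) \<le> d"
      unfolding f(2) Linf_diff_class[OF s(1) f(1)]
      unfolding Linf_norm_le_iff[OF Minf_diff[OF s(1) f(1)] less_imp_le[OF d(1)]]
      using SA(3) by (auto simp: s_def)
    then have "Linf_norm N (Linf_diff N (Linf_class N h) (Linf_class N g1)) < e"
      "Linf_norm N (Linf_diff N (Linf_class N h) (Linf_class N g2)) < e"
      using d1(2)[OF G] d2(2)[OF G] d h(2) s(2) g1(2) g2(2) by auto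
    then have "Linf_norm N (Linf_class N (\<lambda>y. h y - g1 y)) \<le> e"
      "Linf_norm N (Linf_class N (\<lambda>y. h y - g2 y)) \<le> e"
      by (simp_all add: Linf_diff_class h g1 g2)
    then have "AE y in N. cmod (h y - g1 y) \<le> e" "AE y in N. cmod (h y - g2 y) \<le> e"
      using Linf_norm_le_iff[OF Minf_diff[OF h(1) g1(1)], of e]
        Linf_norm_le_iff[OF Minf_diff[OF h(1) g2(1)], of e] e by auto
    then show ?thesis
    proof eventually_elim
      case (elim y)
      have "g1 y - g2 y = (h y - g2 y) - (h y - g1 y)" by simp
      then show ?case using elim norm_triangle_ineq4[of "h y - g2 y" "h y - g1 y"] by simp
    qed
  qed
  \<comment> \<open>The bounds for all \<open>e\<close> reduce to countably many, so their
    exceptional null sets can be united.\<close>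
  then have "AE y in N. \<forall>n. cmod (g1 y - g2 y) \<le> 2 * inverse (real (Suc n))"
    unfolding AE_all_countable by simp
  then have "AE y in N. g1 y = g2 y"
  proof eventually_elim
    case (elim y)
    show ?case
    proof (rule ccontr)
      assume "g1 y \<noteq> g2 y"
      then have "0 < cmod (g1 y - g2 y) / 2" by simp
      then obtain n where "inverse (real (Suc n)) < cmod (g1 y - g2 y) / 2"
        using reals_Archimedean by blast
      then show False using elim[rule_format, of n] by simp
    qed
  qed
  then show "T1 F = T2 F" unfolding g1(2) g2(2) by (rule Linf_class_eqI[OF g1(1) g2(1)])
qed

section \<open>The induced map as a star isomorphism\<close>

context regular_iso
begin

text \<open>The choice ranges over all partners of all representatives, and \<open>hat_class\<close>
  shows that it does not matter. The restriction to \<open>Linf M\<close> matches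
  \<open>\<rightarrow>\<^sub>E\<close> in \<open>Linf_hat\<close>.\<close>

definition hat :: "('a \<Rightarrow> complex) set \<Rightarrow> ('b \<Rightarrow> complex) set" where
  "hat = (\<lambda>F\<in>Linf M. Linf_class N (SOME g. g \<in> Minf N \<and> (\<exists>f\<in>F. rel f g)))"

lemma hat_class:
  assumes f: "f \<in> Minf M" and g: "g \<in> Minf N" and fg: "rel f g"
  shows "hat (Linf_class M f) = Linf_class N g"
proof -
  define g' where "g' = (SOME g. g \<in> Minf N \<and> (\<exists>f'\<in>Linf_class M f. rel f' g))"
  have "\<exists>g. g \<in> Minf N \<and> (\<exists>f'\<in>Linf_class M f. rel f' g)"
    using g fg Linf_class_self[OF f] by blast
  from someI_ex[OF this] obtain f' where g': "g' \<in> Minf N" "f' \<in> Linf_class M f" "rel f' g'"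
    unfolding g'_def by blast
  have "AE x in M. f x = f' x" using g'(2) Linf_class_iff[OF f] by blast
  then have "AE y in N. g y = g' y" using rel_AE_eq_iff[OF fg g'(3)] by simp
  then have "Linf_class N g = Linf_class N g'" by (rule Linf_class_eqI[OF g g'(1)])
  then show ?thesis
    unfolding hat_def g'_def using Linf_class_in_Linf[OF f] by simp
qed

lemma Linf_relE:
  assumes "F \<in> Linf M"
  obtains f g where "f \<in> Minf M" "g \<in> Minf N" "rel f g" "F = Linf_class M f"
    "hat F = Linf_class N g"
  using assms rel_total hat_class by (metis LinfE)

lemma hat_PiE: "hat \<in> Linf M \<rightarrow>\<^sub>E Linf N"
proof
  fix F assume "F \<in> Linf M"
  then show "hat F \<in> Linf N" by (rule Linf_relE) (simp add: Linf_class_in_Linf)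
qed (simp add: hat_def)

lemma rel_complex_binop:
  fixes f1 f2 :: "'a \<Rightarrow> complex"
  assumes "rel f1 g1" "rel f2 g2"
  shows "rel (\<lambda>x. f1 x + f2 x) (\<lambda>y. g1 y + g2 y)"
    "rel (\<lambda>x. f1 x - f2 x) (\<lambda>y. g1 y - g2 y)"
    "rel (\<lambda>x. f1 x * f2 x) (\<lambda>y. g1 y * g2 y)"
  by (intro rel_compose2[OF assms] borel_measurable_continuous_onI continuous_intros)+

lemma hat_linear: "Linf_linear M N hat"
  unfolding Linf_linear_def
proof (intro conjI ballI allI)
  fix F G assume "F \<in> Linf M" "G \<in> Linf M"
  then obtain f f' g g' where *: "f \<in> Minf M" "g \<in> Minf M" "f' \<in> Minf N" "g' \<in> Minf N"
    "rel f f'" "rel g g'" "F = Linf_class M f" "G = Linf_class M g"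
    "hat F = Linf_class N f'" "hat G = Linf_class N g'"
    by (metis Linf_relE)
  show "hat (Linf_add M F G) = Linf_add N (hat F) (hat G)"
    unfolding *(9,10) unfolding *(7,8) Linf_add_class[OF *(1,2)] Linf_add_class[OF *(3,4)]
    by (intro hat_class Minf_add rel_complex_binop *)
next
  fix c F assume "F \<in> Linf M"
  then obtain f f' where *: "f \<in> Minf M" "f' \<in> Minf N" "rel f f'" "F = Linf_class M f"
    "hat F = Linf_class N f'"
    by (metis Linf_relE)
  have "rel (\<lambda>x. c * f x) (\<lambda>y. c * f' y)" by (rule rel_compose[OF *(3)]) measurable
  then show "hat (Linf_scale M c F) = Linf_scale N c (hat F)"
    unfolding *(5) unfolding *(4) Linf_scale_class[OF *(1)] Linf_scale_class[OF *(2)]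
    by (intro hat_class Minf_mult Minf_const *)
qed

text \<open>\<open>rel_AE_iff\<close> transfers every bound on the modulus of a difference, so
  \<open>hat\<close> does not increase distances; half of \<open>e\<close> is taken because these
  bounds are weak.\<close>

lemma hat_norm_continuous: "Linf_norm_continuous M N hat"
  unfolding Linf_norm_continuous_def
proof (intro ballI allI impI)
  fix F and e :: real assume F: "F \<in> Linf M" and e: "e > 0"
  have "Linf_norm N (Linf_diff N (hat G) (hat F)) < e"
    if G: "G \<in> Linf M" and less: "Linf_norm M (Linf_diff M G F) < e / 2" for G
  proof -
    from F G obtain f f' g g' where *: "f \<in> Minf M" "g \<in> Minf M" "f' \<in> Minf N" "g' \<in> Minf N"
      "rel f f'" "rel g g'" "F = Linf_class M f" "G = Linf_class M g"
      "hat F = Linf_class N f'" "hat G = Linf_class N g'"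
      by (metis Linf_relE)
    have "Linf_norm M (Linf_class M (\<lambda>x. g x - f x)) \<le> e / 2"
      using less unfolding *(7,8) Linf_diff_class[OF *(2,1)] by simp
    then have "AE x in M. cmod (g x - f x) \<le> e / 2"
      using Linf_norm_le_iff[OF Minf_diff[OF *(2,1)], of "e / 2"] e by simp
    then have "AE y in N. cmod (g' y - f' y) \<le> e / 2"
      by (subst rel_AE_iff[OF rel_complex_binop(2)[OF *(6,5)], symmetric]) auto
    then have "Linf_norm N (Linf_class N (\<lambda>y. g' y - f' y)) \<le> e / 2"
      using Linf_norm_le_iff[OF Minf_diff[OF *(4,3)], of "e / 2"] e by simp
    then show ?thesis
      unfolding *(9,10) Linf_diff_class[OF *(4,3)] using e by simp
  qed
  then show "\<exists>d>0. \<forall>G\<in>Linf M. Linf_norm M (Linf_diff M G F) < d \<longrightarrow>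
      Linf_norm N (Linf_diff N (hat G) (hat F)) < e"
    using e by (intro exI[of _ "e / 2"]) simp
qed

lemma hat_indicator:
  "A \<in> sets M \<Longrightarrow> hat (Linf_class M (indicator A)) = Linf_class N (indicator (L A))"
  by (intro hat_class Minf_indicator rel_indicator L_in)

lemma Linf_hat_eq: "Linf_hat M N L = hat"
  unfolding Linf_hat_def
proof (rule the_equality, intro conjI ballI)
  fix T assume "T \<in> Linf M \<rightarrow>\<^sub>E Linf N \<and> Linf_linear M N T \<and> Linf_norm_continuous M N T \<and>
    (\<forall>A\<in>sets M. T (Linf_class M (indicator A)) = Linf_class N (indicator (L A)))"
  then show "T = hat"
    using hat_PiE hat_linear hat_norm_continuous hat_indicator by (intro Linf_map_eqI) auto
qed (rule hat_PiE hat_linear hat_norm_continuous hat_indicator; assumption?)+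

text \<open>Well-definedness and injectivity are the two directions of \<open>rel_AE_eq_iff\<close>,
  surjectivity is \<open>rel_surj\<close>, and the algebraic laws hold because \<open>rel\<close> is
  stable under continuous operations.\<close>

lemma hat_star_isomorphism: "Linf_star_isomorphism M N hat"
  unfolding Linf_star_isomorphism_def
proof (intro conjI ballI hat_linear)
  show "bij_betw hat (Linf M) (Linf N)"
  proof (rule bij_betwI')
    fix F G assume "F \<in> Linf M" "G \<in> Linf M"
    then obtain f f' g g' where *: "f \<in> Minf M" "g \<in> Minf M" "f' \<in> Minf N" "g' \<in> Minf N"
      "rel f f'" "rel g g'" "F = Linf_class M f" "G = Linf_class M g"
      "hat F = Linf_class N f'" "hat G = Linf_class N g'"
      by (metis Linf_relE)
    show "hat F = hat G \<longleftrightarrow> F = G"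
      unfolding *(9,10) unfolding *(7,8) Linf_class_eq_iff[OF *(1,2)] Linf_class_eq_iff[OF *(3,4)]
      by (rule rel_AE_eq_iff[OF *(5,6), symmetric])
  next
    fix F assume "F \<in> Linf M"
    then show "hat F \<in> Linf N" by (rule PiE_mem[OF hat_PiE])
  next
    fix G assume "G \<in> Linf N"
    then obtain g where g: "g \<in> Minf N" "G = Linf_class N g" by (rule LinfE)
    then obtain f where f: "f \<in> Minf M" "rel f g" using rel_surj by blast
    then have "G = hat (Linf_class M f)" using hat_class g by simp
    then show "\<exists>F\<in>Linf M. G = hat F" using Linf_class_in_Linf[OF f(1)] by blast
  qed
next
  fix F G assume "F \<in> Linf M" "G \<in> Linf M"
  then obtain f f' g g' where *: "f \<in> Minf M" "g \<in> Minf M" "f' \<in> Minf N" "g' \<in> Minf N"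
    "rel f f'" "rel g g'" "F = Linf_class M f" "G = Linf_class M g"
    "hat F = Linf_class N f'" "hat G = Linf_class N g'"
    by (metis Linf_relE)
  show "hat (Linf_mult M F G) = Linf_mult N (hat F) (hat G)"
    unfolding *(9,10) unfolding *(7,8) Linf_mult_class[OF *(1,2)] Linf_mult_class[OF *(3,4)]
    by (intro hat_class Minf_mult rel_complex_binop *)
next
  fix F assume "F \<in> Linf M"
  then obtain f f' where *: "f \<in> Minf M" "f' \<in> Minf N" "rel f f'" "F = Linf_class M f"
    "hat F = Linf_class N f'"
    by (metis Linf_relE)
  have "rel (\<lambda>x. cnj (f x)) (\<lambda>y. cnj (f' y))"
    by (intro rel_compose[OF *(3)] borel_measurable_continuous_onI continuous_intros)
  then show "hat (Linf_star M F) = Linf_star N (hat F)"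
    unfolding *(5) unfolding *(4) Linf_star_class[OF *(1)] Linf_star_class[OF *(2)]
    by (intro hat_class Minf_cnj *)
qed

end

section \<open>Metric geometry of the positive unit sphere\<close>

text \<open>Real representatives with values in \<open>[0, 1]\<close> everywhere, not just almost
  everywhere. The last clause encodes that the essential supremum reaches 1; on a null space it
  leaves no representative, in accordance with the empty sphere.\<close>

definition sphere_rep :: "'a measure \<Rightarrow> ('a \<Rightarrow> real) set" where
  "sphere_rep M = {r \<in> borel_measurable M. (\<forall>x. 0 \<le> r x \<and> r x \<le> 1) \<and>
    (\<forall>s<1. \<not> (AE x in M. r x \<le> s))}"

lemma sphere_repD:
  assumes "r \<in> sphere_rep M"
  shows "r \<in> borel_measurable M" "0 \<le> r x" "r x \<le> 1" "s < 1 \<Longrightarrow> \<not> (AE x in M. r x \<le> s)"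
  using assms by (auto simp: sphere_rep_def)

abbreviation Linf_of_real :: "'a measure \<Rightarrow> ('a \<Rightarrow> real) \<Rightarrow> ('a \<Rightarrow> complex) set" where
  "Linf_of_real M r \<equiv> Linf_class M (\<lambda>x. complex_of_real (r x))"

lemma sphere_rep_Minf:
  assumes "r \<in> sphere_rep M" shows "(\<lambda>x. complex_of_real (r x)) \<in> Minf M"
proof -
  have "bounded ((\<lambda>x. complex_of_real (r x)) ` space M)"
    by (rule boundedI[of _ 1]) (use sphere_repD(2,3)[OF assms] in auto)
  with sphere_repD(1)[OF assms] show ?thesis by (simp add: Minf_def)
qed

text \<open>Truncating the real part to \<open>[0, 1]\<close> alters an element of the sphere only
  on a null set.\<close>

lemma Linf_possphere_eq: "Linf_possphere M = Linf_of_real M ` sphere_rep M"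
proof (intro set_eqI iffI)
  fix F assume "F \<in> Linf_possphere M"
  then have F: "F \<in> Linf M" "\<And>f. f \<in> F \<Longrightarrow> AE x in M. f x \<in> \<real>\<^sub>\<ge>\<^sub>0" "Linf_norm M F = 1"
    by (auto simp: Linf_possphere_def)
  obtain f where f: "f \<in> Minf M" "F = Linf_class M f" using F(1) by (rule LinfE)
  have [measurable]: "f \<in> borel_measurable M" using f(1) by (simp add: Minf_def)
  have pos: "AE x in M. f x \<in> \<real>\<^sub>\<ge>\<^sub>0" using F(2) Linf_class_self[OF f(1)] f(2) by simp
  have le1: "AE x in M. cmod (f x) \<le> 1"
    using Linf_norm_le_iff[OF f(1), of 1] F(3) f(2) by simp
  define r where "r x = max 0 (min 1 (Re (f x)))" for x
  have fr: "AE x in M. f x = complex_of_real (r x)"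
    using pos le1 by eventually_elim (auto simp: r_def elim!: nonneg_Reals_cases)
  have "\<not> (AE x in M. r x \<le> s)" if s: "s < 1" for s
  proof
    assume "AE x in M. r x \<le> s"
    with fr have "AE x in M. cmod (f x) \<le> max 0 s"
    proof eventually_elim
      case (elim x)
      have "cmod (f x) = r x" unfolding elim(1) norm_of_real by (simp add: r_def)
      with elim(2) show ?case by simp
    qed
    then have "Linf_norm M F \<le> max 0 s"
      using Linf_norm_le_iff[OF f(1), of "max 0 s"] f(2) by simp
    with F(3) s show False by simp
  qed
  moreover have "r \<in> borel_measurable M" unfolding r_def[abs_def] by measurable
  ultimately have r: "r \<in> sphere_rep M" by (simp add: sphere_rep_def r_def)
  have "F = Linf_of_real M r"
    unfolding f(2) by (rule Linf_class_eqI[OF f(1) sphere_rep_Minf[OF r] fr])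
  with r show "F \<in> Linf_of_real M ` sphere_rep M" by blast
next
  fix F assume "F \<in> Linf_of_real M ` sphere_rep M"
  then obtain r where r: "r \<in> sphere_rep M" "F = Linf_of_real M r" by blast
  note R = sphere_rep_Minf[OF r(1)]
  have "AE x in M. f x \<in> \<real>\<^sub>\<ge>\<^sub>0" if "f \<in> F" for f
  proof -
    have "AE x in M. complex_of_real (r x) = f x"
      using that Linf_class_iff[OF R] r(2) by blast
    then show ?thesis
      by eventually_elim (use sphere_repD(2)[OF r(1)] nonneg_Reals_of_real_iff in metis)
  qed
  moreover have le: "Linf_norm M F \<le> s \<longleftrightarrow> (AE x in M. r x \<le> s)" if "0 \<le> s" for s
    using Linf_norm_le_iff[OF R that] sphere_repD(2)[OF r(1)] r(2) by simp
  have "Linf_norm M F = 1"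
  proof (rule antisym)
    show "Linf_norm M F \<le> 1" using le[of 1] sphere_repD(3)[OF r(1)] by simp
    show "1 \<le> Linf_norm M F"
    proof (rule ccontr)
      let ?s = "max 0 (Linf_norm M F)"
      assume "\<not> ?thesis"
      then have "\<not> (AE x in M. r x \<le> ?s)" by (intro sphere_repD(4)[OF r(1)]) simp
      with le[of ?s] show False by simp
    qed
  qed
  ultimately show "F \<in> Linf_possphere M"
    using Linf_class_in_Linf[OF R] r(2) by (simp add: Linf_possphere_def)
qed

lemma Linf_norm_diff_of_real_le_iff:
  assumes "r \<in> sphere_rep M" "r' \<in> sphere_rep M" "0 \<le> s"
  shows "Linf_norm M (Linf_diff M (Linf_of_real M r) (Linf_of_real M r')) \<le> s \<longleftrightarrow>
    (AE x in M. \<bar>r x - r' x\<bar> \<le> s)"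
  unfolding Linf_diff_class[OF sphere_rep_Minf[OF assms(1)] sphere_rep_Minf[OF assms(2)]]
    Linf_norm_le_iff[OF Minf_diff[OF sphere_rep_Minf[OF assms(1)] sphere_rep_Minf[OF assms(2)]] assms(3)]
  by (simp flip: of_real_diff)

text \<open>Membership in the open unit ball, that is, distance strictly below 1. It is phrased by
  weak almost-everywhere bounds because these are what an isometry on representatives
  transports.\<close>

definition near :: "'a measure \<Rightarrow> ('a \<Rightarrow> real) \<Rightarrow> ('a \<Rightarrow> real) \<Rightarrow> bool" where
  "near M f g \<longleftrightarrow> (\<exists>s. 0 \<le> s \<and> s < 1 \<and> (AE x in M. \<bar>f x - g x\<bar> \<le> s))"

lemma nearI:
  assumes "s < 1" "AE x in M. \<bar>f x - g x\<bar> \<le> s"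
  shows "near M f g"
  unfolding near_def
proof (intro exI conjI)
  show "AE x in M. \<bar>f x - g x\<bar> \<le> max 0 s" using assms(2) by eventually_elim simp
qed (use assms(1) in auto)

lemma near_refl: "near M f f"
  by (rule nearI[of 0]) auto

lemma near_AE_cong:
  assumes "AE x in M. f x = f' x" "AE x in M. g x = g' x"
  shows "near M f g \<longleftrightarrow> near M f' g'"
proof -
  have "AE x in M. \<bar>f x - g x\<bar> \<le> s \<longleftrightarrow> \<bar>f' x - g' x\<bar> \<le> s" for s
    using assms by eventually_elim simp
  then have "(AE x in M. \<bar>f x - g x\<bar> \<le> s) \<longleftrightarrow> (AE x in M. \<bar>f' x - g' x\<bar> \<le> s)" for s
    by (rule eventually_subst)
  then show ?thesis by (simp add: near_def)
qed

lemma indicator_sphere_rep: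
  assumes "A \<in> sets M" "\<not> (AE x in M. x \<notin> A)"
  shows "indicator A \<in> sphere_rep M"
proof -
  have "\<not> (AE x in M. (indicator A x :: real) \<le> s)" if "s < 1" for s
  proof
    assume "AE x in M. (indicator A x :: real) \<le> s"
    then have "AE x in M. x \<notin> A" by eventually_elim (use that in \<open>auto simp: indicator_def\<close>)
    with assms(2) show False ..
  qed
  then show ?thesis using assms(1) by (auto simp: sphere_rep_def)
qed

text \<open>Every value strictly between 0 and 1 is caught by some \<open>d\<close> of the form
  \<open>1 / (n + 1)\<close>, so countably many null sets suffice.\<close>

lemma AE_zero_or_oneI:
  fixes a :: "'a \<Rightarrow> real"
  assumes "\<And>x. 0 \<le> a x" "\<And>x. a x \<le> 1"
    and "\<And>d. 0 < d \<Longrightarrow> AE x in M. \<not> (d \<le> a x \<and> a x \<le> 1 - d)"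
  shows "AE x in M. a x = 0 \<or> a x = 1"
proof -
  have "AE x in M. \<forall>n. \<not> (inverse (real (Suc n)) \<le> a x \<and> a x \<le> 1 - inverse (real (Suc n)))"
    unfolding AE_all_countable by (intro allI assms(3)) simp
  then show ?thesis
  proof eventually_elim
    case (elim x)
    show ?case
    proof (rule ccontr)
      assume "\<not> (a x = 0 \<or> a x = 1)"
      then have "0 < min (a x) (1 - a x)" using assms(1,2)[of x] by (auto simp: less_le)
      then obtain n where "inverse (real (Suc n)) < min (a x) (1 - a x)"
        using reals_Archimedean by blast
      with elim[rule_format, of n] show False by auto
    qed
  qed
qed

text \<open>The right-hand side speaks only of balls and almost equality and so survives any
  isometry onto. If \<open>a\<close> has intermediate values on a nonnull set, raising them to 1
  yields a different centre whose ball lies inside that of \<open>a\<close>. If \<open>a\<close> is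
  an indicator, no such other centre exists.\<close>

lemma AE_zero_or_one_iff_near:
  assumes a: "a \<in> sphere_rep M"
  shows "(AE x in M. a x = 0 \<or> a x = 1) \<longleftrightarrow>
    (\<forall>h\<in>sphere_rep M. (\<forall>k\<in>sphere_rep M. near M h k \<longrightarrow> near M a k) \<longrightarrow> (AE x in M. h x = a x))"
    (is "?ind \<longleftrightarrow> ?ball")
proof
  note [measurable] = sphere_repD(1)[OF a]
  assume ind: ?ind
  show ?ball
  proof (intro ballI impI)
    fix h assume h: "h \<in> sphere_rep M"
      and sub: "\<forall>k\<in>sphere_rep M. near M h k \<longrightarrow> near M a k"
    note [measurable] = sphere_repD(1)[OF h]
    have "AE x in M. h x = 0 \<or> h x = 1"
    proof (rule AE_zero_or_oneI)
      fix d :: real assume d: "0 < d"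
      \<comment> \<open>Where \<open>h\<close> is intermediate, \<open>k\<close> takes the value
        opposite to \<open>a\<close>. It stays in the ball around \<open>h\<close> but has distance
        1 from \<open>a\<close> on that set, which must therefore be null.\<close>
      define k where
        "k x = (if d \<le> h x \<and> h x \<le> 1 - d then if a x = 1 then 0 else 1 else h x)" for x
      have "\<not> (AE x in M. k x \<le> s)" if s: "s < 1" for s
      proof
        assume "AE x in M. k x \<le> s"
        then have "AE x in M. h x \<le> max s (1 - d)"
          by eventually_elim (auto simp: k_def le_max_iff_disj split: if_splits)
        then show False using sphere_repD(4)[OF h, of "max s (1 - d)"] s d by simp
      qed
      moreover have "k \<in> borel_measurable M" unfolding k_def[abs_def] by measurable
      ultimately have "k \<in> sphere_rep M"
        using sphere_repD(2,3)[OF h] by (simp add: sphere_rep_def k_def)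
      moreover have "near M h k"
      proof (rule nearI[of "max 0 (1 - d)"])
        have "\<bar>h x - k x\<bar> \<le> max 0 (1 - d)" for x
          using sphere_repD(2,3)[OF h, of x] d by (auto simp: k_def le_max_iff_disj)
        then show "AE x in M. \<bar>h x - k x\<bar> \<le> max 0 (1 - d)" by simp
      qed (use d in auto)
      ultimately obtain s where "s < 1" "AE x in M. \<bar>a x - k x\<bar> \<le> s"
        using sub by (auto simp: near_def)
      with ind show "AE x in M. \<not> (d \<le> h x \<and> h x \<le> 1 - d)"
        by (elim AE_mp) (auto simp: k_def split: if_splits intro!: AE_I2)
    qed (use sphere_repD(2,3)[OF h] in auto)
    \<comment> \<open>Since \<open>h\<close> lies in its own ball it is near \<open>a\<close>, and
      two functions with values 0 and 1 at distance below 1 agree.\<close>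
    moreover obtain s where "s < 1" "AE x in M. \<bar>a x - h x\<bar> \<le> s"
      using sub h near_refl by (metis near_def)
    ultimately show "AE x in M. h x = a x"
      using ind by (elim AE_mp) (auto intro!: AE_I2)
  qed
next
  note [measurable] = sphere_repD(1)[OF a]
  assume ball: ?ball
  show ?ind
  proof (rule AE_zero_or_oneI)
    fix d :: real assume d: "0 < d"
    \<comment> \<open>Where \<open>h\<close> differs from \<open>a\<close>, the value of
      \<open>a\<close> lies in \<open>[d, 1 - d]\<close> and is within \<open>1 - d\<close> of every
      point of \<open>[0, 1]\<close>; elsewhere nothing changes. Hence the ball around
      \<open>h\<close> lies in the ball around \<open>a\<close>.\<close>
    define h where "h x = (if d \<le> a x \<and> a x \<le> 1 - d then 1 else a x)" for x
    have ah: "a x \<le> h x" for x using sphere_repD(3)[OF a, of x] by (auto simp: h_def)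
    have "\<not> (AE x in M. h x \<le> s)" if s: "s < 1" for s
    proof
      assume "AE x in M. h x \<le> s"
      then have "AE x in M. a x \<le> s" by eventually_elim (use ah order_trans in blast)
      then show False using sphere_repD(4)[OF a s] by simp
    qed
    moreover have "h \<in> borel_measurable M" unfolding h_def[abs_def] by measurable
    ultimately have h: "h \<in> sphere_rep M"
      using sphere_repD(2,3)[OF a] by (simp add: sphere_rep_def h_def)
    have "near M a k" if k: "k \<in> sphere_rep M" and hk: "near M h k" for k
    proof -
      obtain s where s: "s < 1" "AE x in M. \<bar>h x - k x\<bar> \<le> s" using hk by (auto simp: near_def)
      show ?thesis
      proof (rule nearI[of "max s (1 - d)"])
        show "AE x in M. \<bar>a x - k x\<bar> \<le> max s (1 - d)"
          using s(2)
        proof eventually_elim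
          case (elim x)
          then show ?case
            using sphere_repD(2,3)[OF k, of x] by (auto simp: h_def split: if_splits)
        qed
      qed (use s d in auto)
    qed
    with ball h have "AE x in M. h x = a x" by blast
    then show "AE x in M. \<not> (d \<le> a x \<and> a x \<le> 1 - d)"
      by eventually_elim (use d in \<open>auto simp: h_def split: if_splits\<close>)
  qed (use sphere_repD(2,3)[OF a] in auto)
qed

text \<open>For disjoint sets, at almost every point one of the two indicators is 0, so a common
  member of both balls would be bounded by a constant below 1, which the sphere forbids.\<close>

lemma AE_disjoint_iff_near:
  assumes A: "A \<in> sets M" "\<not> (AE x in M. x \<notin> A)" and B: "B \<in> sets M" "\<not> (AE x in M. x \<notin> B)"
  shows "(AE x in M. \<not> (x \<in> A \<and> x \<in> B)) \<longleftrightarrow>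
    \<not> (\<exists>g\<in>sphere_rep M. near M (indicator A) g \<and> near M (indicator B) g)"
proof
  assume disj: "AE x in M. \<not> (x \<in> A \<and> x \<in> B)"
  show "\<not> (\<exists>g\<in>sphere_rep M. near M (indicator A) g \<and> near M (indicator B) g)"
  proof
    assume "\<exists>g\<in>sphere_rep M. near M (indicator A) g \<and> near M (indicator B) g"
    then obtain g s t where g: "g \<in> sphere_rep M" and st: "s < 1" "t < 1"
      "AE x in M. \<bar>indicator A x - g x\<bar> \<le> s" "AE x in M. \<bar>indicator B x - g x\<bar> \<le> t"
      by (auto simp: near_def)
    have "AE x in M. g x \<le> max s t"
      using st(3,4) disj by eventually_elim (auto simp: indicator_def split: if_splits)
    then show False using sphere_repD(4)[OF g, of "max s t"] st(1,2) by simp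
  qed
next
  assume *: "\<not> (\<exists>g\<in>sphere_rep M. near M (indicator A) g \<and> near M (indicator B) g)"
  show "AE x in M. \<not> (x \<in> A \<and> x \<in> B)"
  proof (rule ccontr)
    assume nonnull: "\<not> ?thesis"
    \<comment> \<open>The value 1/2 is at distance 1/2 from both 0 and 1, and the value 1 on the
      nonnull intersection puts \<open>g\<close> in the sphere.\<close>
    define g :: "'a \<Rightarrow> real" where "g x = (if x \<in> A \<inter> B then 1 else 1 / 2)" for x
    have "\<not> (AE x in M. g x \<le> s)" if s: "s < 1" for s
    proof
      assume "AE x in M. g x \<le> s"
      then have "AE x in M. \<not> (x \<in> A \<and> x \<in> B)"
        by eventually_elim (use s in \<open>auto simp: g_def split: if_splits\<close>)
      with nonnull show False ..
    qed
    moreover have "g \<in> borel_measurable M"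
      unfolding g_def[abs_def] using A(1) B(1) by measurable
    ultimately have "g \<in> sphere_rep M" by (simp add: sphere_rep_def g_def)
    moreover have "near M (indicator A) g" "near M (indicator B) g"
      by (auto intro!: nearI[of "1/2"] AE_I2 simp: g_def indicator_def)
    ultimately show False using * by blast
  qed
qed

text \<open>Disjointness determines inclusion: a set lies in another as soon as everything disjoint
  from the latter is disjoint from the former. Surjectivity supplies enough test sets on the target
  side.\<close>

lemma regular_iso_disjointI:
  assumes L: "\<And>A. A \<in> sets M \<Longrightarrow> L A \<in> sets N"
    and disj: "\<And>A B. A \<in> sets M \<Longrightarrow> B \<in> sets M \<Longrightarrow>
      (AE y in N. \<not> (y \<in> L A \<and> y \<in> L B)) \<longleftrightarrow> (AE x in M. \<not> (x \<in> A \<and> x \<in> B))"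
    and surj: "\<And>B. B \<in> sets N \<Longrightarrow> \<exists>A\<in>sets M. AE y in N. y \<in> L A \<longleftrightarrow> y \<in> B"
  shows "regular_iso M N L"
proof
  fix A assume A: "A \<in> sets M"
  show "(AE y in N. y \<notin> L A) \<longleftrightarrow> (AE x in M. x \<notin> A)" using disj[OF A A] by simp
next
  fix A B assume A: "A \<in> sets M" and B: "B \<in> sets M"
  define D where "D = A - B"
  have D: "D \<in> sets M" using A B by (simp add: D_def sets.Diff)
  have DB: "AE y in N. \<not> (y \<in> L D \<and> y \<in> L B)"
    using disj[OF D B] by (simp add: D_def)
  have DA: "AE y in N. y \<in> L D \<longrightarrow> y \<in> L A"
  proof -
    \<comment> \<open>\<open>C\<close> stands for the part of \<open>L D\<close> outside
      \<open>L A\<close>. Being disjoint from \<open>A\<close> it is disjoint from \<open>D\<close>,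
      so that part is null.\<close>
    obtain C where C: "C \<in> sets M" "AE y in N. y \<in> L C \<longleftrightarrow> y \<in> L D - L A"
      using surj[of "L D - L A"] L A D by blast
    have "AE y in N. \<not> (y \<in> L C \<and> y \<in> L A)" using C(2) by eventually_elim auto
    then have "AE x in M. \<not> (x \<in> C \<and> x \<in> A)" using disj[OF C(1) A] by simp
    then have "AE x in M. \<not> (x \<in> C \<and> x \<in> D)" by eventually_elim (auto simp: D_def)
    then have "AE y in N. \<not> (y \<in> L C \<and> y \<in> L D)" using disj[OF C(1) D] by simp
    with C(2) show ?thesis by eventually_elim auto
  qed
  have AD: "AE y in N. y \<in> L A \<longrightarrow> y \<in> L B \<or> y \<in> L D"
  proof -
    \<comment> \<open>Here \<open>C\<close> stands for the part of \<open>L A\<close> outside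
      \<open>L B\<close> and \<open>L D\<close>; it is disjoint from \<open>B\<close> and
      \<open>D\<close>, hence from \<open>A\<close>.\<close>
    obtain C where C: "C \<in> sets M" "AE y in N. y \<in> L C \<longleftrightarrow> y \<in> L A - L B - L D"
      using surj[of "L A - L B - L D"] L A B D by blast
    have "AE y in N. \<not> (y \<in> L C \<and> y \<in> L B)" "AE y in N. \<not> (y \<in> L C \<and> y \<in> L D)"
      using C(2) by (eventually_elim, auto)+
    then have "AE x in M. \<not> (x \<in> C \<and> x \<in> B)" "AE x in M. \<not> (x \<in> C \<and> x \<in> D)"
      using disj[OF C(1) B] disj[OF C(1) D] by simp_all
    then have "AE x in M. \<not> (x \<in> C \<and> x \<in> A)" by eventually_elim (auto simp: D_def)
    then have "AE y in N. \<not> (y \<in> L C \<and> y \<in> L A)" using disj[OF C(1) A] by simp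
    with C(2) show ?thesis by eventually_elim auto
  qed
  show "AE y in N. y \<in> L (A - B) \<longleftrightarrow> y \<in> L A \<and> y \<notin> L B"
    using DB DA AD unfolding D_def[symmetric] by eventually_elim auto
qed (use L surj in auto)

lemma AE_dist_indicator_le_iff:
  assumes r: "r \<in> sphere_rep M" and s: "0 \<le> s"
  shows "(AE x in M. \<bar>r x - indicator A x\<bar> \<le> s) \<longleftrightarrow>
    (AE x in M. (s < r x \<longrightarrow> x \<in> A) \<and> (x \<in> A \<longrightarrow> 1 - s \<le> r x))"
proof (rule AE_cong)
  fix x
  show "\<bar>r x - indicator A x\<bar> \<le> s \<longleftrightarrow> (s < r x \<longrightarrow> x \<in> A) \<and> (x \<in> A \<longrightarrow> 1 - s \<le> r x)"
    using sphere_repD(2,3)[OF r, of x] by (cases "x \<in> A") auto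
qed

text \<open>The isometry lifted to representatives, with surjectivity only up to null sets. Taking
  \<open>s\<close> to be 0 in the distance condition gives injectivity and independence of the
  representative.\<close>

locale sphere_isometry =
  fixes M :: "'a measure" and N :: "'b measure" and \<phi> :: "('a \<Rightarrow> real) \<Rightarrow> ('b \<Rightarrow> real)"
  assumes in_rep: "\<And>r. r \<in> sphere_rep M \<Longrightarrow> \<phi> r \<in> sphere_rep N"
    and isometry: "\<And>r r' s. r \<in> sphere_rep M \<Longrightarrow> r' \<in> sphere_rep M \<Longrightarrow> 0 \<le> s \<Longrightarrow>
      (AE y in N. \<bar>\<phi> r y - \<phi> r' y\<bar> \<le> s) \<longleftrightarrow> (AE x in M. \<bar>r x - r' x\<bar> \<le> s)"
    and surj: "\<And>p. p \<in> sphere_rep N \<Longrightarrow> \<exists>r\<in>sphere_rep M. AE y in N. \<phi> r y = p y"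
begin

lemma near_iff: "r \<in> sphere_rep M \<Longrightarrow> r' \<in> sphere_rep M \<Longrightarrow> near N (\<phi> r) (\<phi> r') \<longleftrightarrow> near M r r'"
  using isometry by (auto simp: near_def)

lemma AE_eq_iff:
  "r \<in> sphere_rep M \<Longrightarrow> r' \<in> sphere_rep M \<Longrightarrow>
    (AE y in N. \<phi> r y = \<phi> r' y) \<longleftrightarrow> (AE x in M. r x = r' x)"
  using isometry[of r r' 0] by simp

lemma near_subset_iff:
  assumes h: "h \<in> sphere_rep M" and r: "r \<in> sphere_rep M"
  shows "(\<forall>k\<in>sphere_rep N. near N (\<phi> h) k \<longrightarrow> near N (\<phi> r) k) \<longleftrightarrow>
    (\<forall>k\<in>sphere_rep M. near M h k \<longrightarrow> near M r k)"
proof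
  assume *: "\<forall>k\<in>sphere_rep M. near M h k \<longrightarrow> near M r k"
  show "\<forall>k\<in>sphere_rep N. near N (\<phi> h) k \<longrightarrow> near N (\<phi> r) k"
  proof
    fix k assume "k \<in> sphere_rep N"
    then obtain k' where k': "k' \<in> sphere_rep M" "AE y in N. \<phi> k' y = k y" using surj by blast
    have "near N (\<phi> f) (\<phi> k') \<longleftrightarrow> near N (\<phi> f) k" for f
      using k'(2) by (intro near_AE_cong) auto
    with * near_iff[OF h k'(1)] near_iff[OF r k'(1)] k'(1)
    show "near N (\<phi> h) k \<longrightarrow> near N (\<phi> r) k" by simp
  qed
next
  assume *: "\<forall>k\<in>sphere_rep N. near N (\<phi> h) k \<longrightarrow> near N (\<phi> r) k"
  show "\<forall>k\<in>sphere_rep M. near M h k \<longrightarrow> near M r k"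
    using * in_rep near_iff[OF h] near_iff[OF r] by blast
qed

text \<open>The characterisation by balls is transported in both directions, points of the target
  sphere being replaced by images under \<open>\<phi>\<close>.\<close>

lemma AE_zero_or_one_iff:
  assumes r: "r \<in> sphere_rep M"
  shows "(AE y in N. \<phi> r y = 0 \<or> \<phi> r y = 1) \<longleftrightarrow> (AE x in M. r x = 0 \<or> r x = 1)"
  unfolding AE_zero_or_one_iff_near[OF r] AE_zero_or_one_iff_near[OF in_rep[OF r]]
proof (intro iffI ballI impI)
  fix h assume h: "h \<in> sphere_rep M" "\<forall>k\<in>sphere_rep M. near M h k \<longrightarrow> near M r k"
    and "\<forall>h\<in>sphere_rep N. (\<forall>k\<in>sphere_rep N. near N h k \<longrightarrow> near N (\<phi> r) k) \<longrightarrow>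
      (AE y in N. h y = \<phi> r y)"
  then have "AE y in N. \<phi> h y = \<phi> r y"
    using in_rep[OF h(1)] near_subset_iff[OF h(1) r] by blast
  then show "AE x in M. h x = r x" using AE_eq_iff[OF h(1) r] by blast
next
  fix h assume h: "h \<in> sphere_rep N" "\<forall>k\<in>sphere_rep N. near N h k \<longrightarrow> near N (\<phi> r) k"
    and *: "\<forall>h\<in>sphere_rep M. (\<forall>k\<in>sphere_rep M. near M h k \<longrightarrow> near M r k) \<longrightarrow>
      (AE x in M. h x = r x)"
  obtain h' where h': "h' \<in> sphere_rep M" "AE y in N. \<phi> h' y = h y" using surj[OF h(1)] by blast
  have "near N (\<phi> h') k \<longleftrightarrow> near N h k" for k
    using h'(2) by (intro near_AE_cong) auto
  with h(2) have "AE x in M. h' x = r x"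
    using * h'(1) near_subset_iff[OF h'(1) r] by simp
  then have "AE y in N. \<phi> h' y = \<phi> r y" using AE_eq_iff[OF h'(1) r] by blast
  with h'(2) show "AE y in N. h y = \<phi> r y" by eventually_elim simp
qed

text \<open>The indicator of a null set is not in the sphere, so \<open>\<phi>\<close> carries no
  information there and the value is fixed as the empty set.\<close>

definition set_map :: "'a set \<Rightarrow> 'b set" where
  "set_map A = (if AE x in M. x \<notin> A then {} else {y\<in>space N. \<phi> (indicator A) y = 1})"

lemma set_map_in:
  assumes A: "A \<in> sets M" shows "set_map A \<in> sets N"
proof (cases "AE x in M. x \<notin> A")
  case False
  note [measurable] = sphere_repD(1)[OF in_rep[OF indicator_sphere_rep[OF A False]]]
  show ?thesis using False by (simp add: set_map_def)
qed (simp add: set_map_def)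

lemma indicator_set_map:
  assumes A: "A \<in> sets M" "\<not> (AE x in M. x \<notin> A)"
  shows "AE y in N. \<phi> (indicator A) y = indicator (set_map A) y"
proof -
  have "AE y in N. \<phi> (indicator A) y = 0 \<or> \<phi> (indicator A) y = 1"
    by (subst AE_zero_or_one_iff[OF indicator_sphere_rep[OF A]]) (auto simp: indicator_def)
  with AE_space show ?thesis
    by eventually_elim (use A in \<open>auto simp: set_map_def indicator_def\<close>)
qed

lemma set_map_nonnull:
  assumes A: "A \<in> sets M" "\<not> (AE x in M. x \<notin> A)"
  shows "\<not> (AE y in N. y \<notin> set_map A)"
proof
  assume "AE y in N. y \<notin> set_map A"
  with indicator_set_map[OF A] have "AE y in N. \<phi> (indicator A) y \<le> 0"
    by eventually_elim simp
  then show False using sphere_repD(4)[OF in_rep[OF indicator_sphere_rep[OF A]], of 0] by simp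
qed

lemma set_map_disjoint_iff:
  assumes A: "A \<in> sets M" and B: "B \<in> sets M"
  shows "(AE y in N. \<not> (y \<in> set_map A \<and> y \<in> set_map B)) \<longleftrightarrow> (AE x in M. \<not> (x \<in> A \<and> x \<in> B))"
proof -
  consider "AE x in M. x \<notin> A" | "AE x in M. x \<notin> B"
    | (nonnull) "\<not> (AE x in M. x \<notin> A)" "\<not> (AE x in M. x \<notin> B)" by blast
  then show ?thesis
  proof cases
    case 1
    moreover from 1 have "AE x in M. \<not> (x \<in> A \<and> x \<in> B)" by eventually_elim simp
    ultimately show ?thesis by (simp add: set_map_def)
  next
    case 2
    moreover from 2 have "AE x in M. \<not> (x \<in> A \<and> x \<in> B)" by eventually_elim simp
    ultimately show ?thesis by (simp add: set_map_def)
  next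
    case nonnull
    note IA = indicator_sphere_rep[OF A nonnull(1)] and IB = indicator_sphere_rep[OF B nonnull(2)]
    have eq: "near N (indicator (set_map C)) p \<longleftrightarrow> near M (indicator C) r"
      if C: "C \<in> sets M" "\<not> (AE x in M. x \<notin> C)" and r: "r \<in> sphere_rep M" "AE y in N. \<phi> r y = p y"
      for C p r
      using near_AE_cong[OF indicator_set_map[OF C] r(2)] near_iff[OF indicator_sphere_rep[OF C] r(1)]
      by simp
    have "(\<exists>g\<in>sphere_rep N. near N (indicator (set_map A)) g \<and> near N (indicator (set_map B)) g) \<longleftrightarrow>
      (\<exists>g\<in>sphere_rep M. near M (indicator A) g \<and> near M (indicator B) g)" (is "?N \<longleftrightarrow> ?M")
    proof
      assume ?N
      then obtain p where p: "p \<in> sphere_rep N" "near N (indicator (set_map A)) p"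
        "near N (indicator (set_map B)) p" by blast
      obtain r where r: "r \<in> sphere_rep M" "AE y in N. \<phi> r y = p y" using surj[OF p(1)] by blast
      show ?M
        using p(2,3) eq[OF A nonnull(1) r] eq[OF B nonnull(2) r] r(1) by blast
    next
      assume ?M
      then obtain r where r: "r \<in> sphere_rep M" "near M (indicator A) r" "near M (indicator B) r"
        by blast
      show ?N
        using r(2,3) eq[OF A nonnull(1) r(1), of "\<phi> r"] eq[OF B nonnull(2) r(1), of "\<phi> r"]
          in_rep[OF r(1)] by auto
    qed
    then show ?thesis
      using AE_disjoint_iff_near[OF A nonnull(1) B nonnull(2)]
        AE_disjoint_iff_near[OF set_map_in[OF A] set_map_nonnull[OF A nonnull(1)]
          set_map_in[OF B] set_map_nonnull[OF B nonnull(2)]]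
      by blast
  qed
qed

text \<open>A preimage of the indicator of \<open>B\<close> takes almost only the values 0 and 1,
  hence is the indicator of the set where it equals 1.\<close>

lemma set_map_surj:
  assumes B: "B \<in> sets N"
  shows "\<exists>A\<in>sets M. AE y in N. y \<in> set_map A \<longleftrightarrow> y \<in> B"
proof (cases "AE y in N. y \<notin> B")
  case True
  then show ?thesis by (intro bexI[of _ "{}"]) (auto simp: set_map_def)
next
  case False
  obtain r where r: "r \<in> sphere_rep M" "AE y in N. \<phi> r y = indicator B y"
    using surj[OF indicator_sphere_rep[OF B False]] by blast
  have "AE y in N. \<phi> r y = 0 \<or> \<phi> r y = 1"
    using r(2) by eventually_elim (simp add: indicator_def)
  then have r01: "AE x in M. r x = 0 \<or> r x = 1" by (simp add: AE_zero_or_one_iff[OF r(1)])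
  note [measurable] = sphere_repD(1)[OF r(1)]
  define A where "A = {x\<in>space M. r x = 1}"
  have A: "A \<in> sets M" unfolding A_def by measurable
  have rA: "AE x in M. r x = indicator A x"
    using r01 AE_space by eventually_elim (auto simp: A_def indicator_def)
  have nonnull: "\<not> (AE x in M. x \<notin> A)"
  proof
    assume "AE x in M. x \<notin> A"
    with rA have "AE x in M. r x \<le> 0" by eventually_elim simp
    then show False using sphere_repD(4)[OF r(1), of 0] by simp
  qed
  have "AE y in N. \<phi> r y = \<phi> (indicator A) y"
    using rA AE_eq_iff[OF r(1) indicator_sphere_rep[OF A nonnull]] by blast
  with r(2) indicator_set_map[OF A nonnull] have "AE y in N. y \<in> set_map A \<longleftrightarrow> y \<in> B"
    by eventually_elim (auto simp: indicator_def split: if_splits)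
  with A show ?thesis by blast
qed

sublocale regular_iso M N set_map
  by (rule regular_iso_disjointI) (use set_map_in set_map_disjoint_iff set_map_surj in auto)

section \<open>Level sets and identification of the isometry\<close>

lemma dist_indicator_iff:
  assumes r: "r \<in> sphere_rep M" and A: "A \<in> sets M" "\<not> (AE x in M. x \<notin> A)" and s: "0 \<le> s"
  shows "(AE y in N. (s < \<phi> r y \<longrightarrow> y \<in> set_map A) \<and> (y \<in> set_map A \<longrightarrow> 1 - s \<le> \<phi> r y)) \<longleftrightarrow>
    (AE x in M. (s < r x \<longrightarrow> x \<in> A) \<and> (x \<in> A \<longrightarrow> 1 - s \<le> r x))"
proof -
  have "(AE y in N. \<bar>\<phi> r y - indicator (set_map A) y\<bar> \<le> s) \<longleftrightarrow>
      (AE y in N. \<bar>\<phi> r y - \<phi> (indicator A) y\<bar> \<le> s)"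
    by (rule eventually_subst[OF eventually_mono[OF indicator_set_map[OF A]]]) simp
  also have "\<dots> \<longleftrightarrow> (AE x in M. \<bar>r x - indicator A x\<bar> \<le> s)"
    by (rule isometry[OF r indicator_sphere_rep[OF A] s])
  finally show ?thesis
    unfolding AE_dist_indicator_le_iff[OF r s] AE_dist_indicator_le_iff[OF in_rep[OF r] s] .
qed

text \<open>Call a set admissible if its indicator has distance at most \<open>s\<close> from
  \<open>r\<close>. Since \<open>1 - s\<close> is at most \<open>s\<close>, both level sets are
  admissible, one the least and the other the greatest up to null sets. \<open>set_map\<close>
  respects admissibility and inclusion, so it matches these extremes with those of
  \<open>\<phi> r\<close>.\<close>

lemma set_map_level:
  assumes r: "r \<in> sphere_rep M" and s: "1 / 2 \<le> s" "s < 1"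
  shows "AE y in N. y \<in> set_map {x\<in>space M. s < r x} \<longleftrightarrow> s < \<phi> r y"
    and "AE y in N. y \<in> set_map {x\<in>space M. 1 - s \<le> r x} \<longleftrightarrow> 1 - s \<le> \<phi> r y"
proof -
  note [measurable] = sphere_repD(1)[OF r] sphere_repD(1)[OF in_rep[OF r]]
  have s0: "0 \<le> s" using s by simp
  define A1 A2 where "A1 = {x\<in>space M. s < r x}" and "A2 = {x\<in>space M. 1 - s \<le> r x}"
  define B1 B2 where "B1 = {y\<in>space N. s < \<phi> r y}" and "B2 = {y\<in>space N. 1 - s \<le> \<phi> r y}"
  have AB: "A1 \<in> sets M" "A2 \<in> sets M" "B1 \<in> sets N" "B2 \<in> sets N"
    unfolding A1_def A2_def B1_def B2_def by measurable
  have A1: "\<not> (AE x in M. x \<notin> A1)"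
  proof
    assume "AE x in M. x \<notin> A1"
    with AE_space have "AE x in M. r x \<le> s" by eventually_elim (auto simp: A1_def)
    with sphere_repD(4)[OF r s(2)] show False ..
  qed
  have A2: "\<not> (AE x in M. x \<notin> A2)"
  proof
    assume "AE x in M. x \<notin> A2"
    then have "AE x in M. x \<notin> A1" by eventually_elim (use s in \<open>auto simp: A1_def A2_def\<close>)
    with A1 show False ..
  qed
  have B1: "\<not> (AE y in N. y \<notin> B1)"
  proof
    assume "AE y in N. y \<notin> B1"
    with AE_space have "AE y in N. \<phi> r y \<le> s" by eventually_elim (auto simp: B1_def)
    with sphere_repD(4)[OF in_rep[OF r] s(2)] show False ..
  qed
  have B2: "\<not> (AE y in N. y \<notin> B2)"
  proof
    assume "AE y in N. y \<notin> B2"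
    then have "AE y in N. y \<notin> B1" by eventually_elim (use s in \<open>auto simp: B1_def B2_def\<close>)
    with B1 show False ..
  qed
  \<comment> \<open>Level sets of \<open>\<phi> r\<close> are pulled back to nonnull sets, as
    \<open>dist_indicator_iff\<close> needs indicators in the sphere.\<close>
  have pre: "\<exists>C\<in>sets M. \<not> (AE x in M. x \<notin> C) \<and> (AE y in N. y \<in> set_map C \<longleftrightarrow> y \<in> B)"
    if B: "B \<in> sets N" "\<not> (AE y in N. y \<notin> B)" for B
  proof -
    obtain C where C: "C \<in> sets M" "AE y in N. y \<in> set_map C \<longleftrightarrow> y \<in> B"
      using set_map_surj[OF B(1)] by blast
    have "(AE y in N. y \<notin> set_map C) \<longleftrightarrow> (AE y in N. y \<notin> B)"
      by (rule eventually_subst[OF eventually_mono[OF C(2)]]) simp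
    with C B(2) L_null[OF C(1)] show ?thesis by blast
  qed
  obtain C1 where C1: "C1 \<in> sets M" "\<not> (AE x in M. x \<notin> C1)" "AE y in N. y \<in> set_map C1 \<longleftrightarrow> y \<in> B1"
    using pre[OF AB(3) B1] by blast
  obtain C2 where C2: "C2 \<in> sets M" "\<not> (AE x in M. x \<notin> C2)" "AE y in N. y \<in> set_map C2 \<longleftrightarrow> y \<in> B2"
    using pre[OF AB(4) B2] by blast
  \<comment> \<open>Admissibility of \<open>A1\<close> shows that its image contains
    \<open>B1\<close>; that of \<open>C1\<close>, inherited from \<open>B1\<close>, gives the other
    inclusion because \<open>A1\<close> is least.\<close>
  have "AE y in N. (s < \<phi> r y \<longrightarrow> y \<in> set_map A1) \<and> (y \<in> set_map A1 \<longrightarrow> 1 - s \<le> \<phi> r y)"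
    by (subst dist_indicator_iff[OF r AB(1) A1 s0]) (use s in \<open>auto simp: A1_def\<close>)
  moreover have "AE y in N. (s < \<phi> r y \<longrightarrow> y \<in> set_map C1) \<and> (y \<in> set_map C1 \<longrightarrow> 1 - s \<le> \<phi> r y)"
    using C1(3) AE_space by eventually_elim (use s in \<open>auto simp: B1_def\<close>)
  then have "AE x in M. (s < r x \<longrightarrow> x \<in> C1) \<and> (x \<in> C1 \<longrightarrow> 1 - s \<le> r x)"
    by (simp only: dist_indicator_iff[OF r C1(1,2) s0])
  then have "AE x in M. x \<in> A1 \<longrightarrow> x \<in> C1" by eventually_elim (auto simp: A1_def)
  then have "AE y in N. y \<in> set_map A1 \<longrightarrow> y \<in> set_map C1"
    by (simp only: L_AE_subset_iff[OF AB(1) C1(1)])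
  ultimately show "AE y in N. y \<in> set_map {x\<in>space M. s < r x} \<longleftrightarrow> s < \<phi> r y"
    using C1(3) unfolding A1_def[symmetric] by eventually_elim (auto simp: B1_def)
  \<comment> \<open>The same argument with inclusions reversed, \<open>A2\<close> being the greatest
    admissible set.\<close>
  have "AE y in N. (s < \<phi> r y \<longrightarrow> y \<in> set_map A2) \<and> (y \<in> set_map A2 \<longrightarrow> 1 - s \<le> \<phi> r y)"
    by (subst dist_indicator_iff[OF r AB(2) A2 s0]) (use s in \<open>auto simp: A2_def\<close>)
  moreover have "AE y in N. (s < \<phi> r y \<longrightarrow> y \<in> set_map C2) \<and> (y \<in> set_map C2 \<longrightarrow> 1 - s \<le> \<phi> r y)"
    using C2(3) AE_space by eventually_elim (use s in \<open>auto simp: B2_def\<close>)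
  then have "AE x in M. (s < r x \<longrightarrow> x \<in> C2) \<and> (x \<in> C2 \<longrightarrow> 1 - s \<le> r x)"
    by (simp only: dist_indicator_iff[OF r C2(1,2) s0])
  with AE_space have "AE x in M. x \<in> C2 \<longrightarrow> x \<in> A2" by eventually_elim (auto simp: A2_def)
  then have "AE y in N. y \<in> set_map C2 \<longrightarrow> y \<in> set_map A2"
    by (simp only: L_AE_subset_iff[OF C2(1) AB(2)])
  ultimately show "AE y in N. y \<in> set_map {x\<in>space M. 1 - s \<le> r x} \<longleftrightarrow> 1 - s \<le> \<phi> r y"
    using C2(3) AE_space unfolding A2_def[symmetric] by eventually_elim (auto simp: B2_def)
qed

text \<open>The open rays generate the Borel sets. Strict levels from 1/2 up to 1 come directly from
  \<open>set_map_level\<close>, those in \<open>[0, 1/2)\<close> are countable unions of weak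
  levels, and the remaining ones are trivial.\<close>

lemma rel_isometry:
  assumes r: "r \<in> sphere_rep M"
  shows "rel r (\<phi> r)"
proof (rule rel_generatorI)
  note p = in_rep[OF r]
  show "r \<in> borel_measurable M" "\<phi> r \<in> borel_measurable N"
    using sphere_repD(1)[OF r] sphere_repD(1)[OF p] .
  note [measurable] = this
  show "sets (borel :: real measure) = sigma_sets UNIV (range greaterThan)"
    by (subst borel_Ioi) simp
  fix U :: "real set" assume "U \<in> range greaterThan"
  then obtain t where U: "U = {t<..}" by auto
  have vim: "r -` U \<inter> space M = {x\<in>space M. t < r x}" by (auto simp: U)
  consider "t < 0" | "0 \<le> t" "t < 1 / 2" | "1 / 2 \<le> t" "t < 1" | "1 \<le> t" by linarith
  then show "AE y in N. y \<in> set_map (r -` U \<inter> space M) \<longleftrightarrow> \<phi> r y \<in> U"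
  proof cases
    case 1
    have "{x\<in>space M. t < r x} = space M" using 1 sphere_repD(2)[OF r] less_le_trans by blast
    moreover have "\<phi> r y \<in> U" for y using 1 sphere_repD(2)[OF p, of y] by (simp add: U)
    ultimately show ?thesis using L_space vim by simp
  next
    case 2
    \<comment> \<open>The scaling keeps \<open>t + c n\<close> in \<open>(0, 1/2]\<close>, so
      \<open>1 - (t + c n)\<close> is a permitted \<open>s\<close> in \<open>set_map_level\<close>,
      while \<open>c n\<close> tends to 0.\<close>
    define c where "c n = (1 / 2 - t) * inverse (real (Suc n))" for n
    have c: "0 < c n" "c n \<le> 1 / 2 - t" for n
    proof -
      show "0 < c n" using 2 by (simp add: c_def)
      have "inverse (real (Suc n)) \<le> 1" by (simp add: inverse_le_1_iff)
      then show "c n \<le> 1 / 2 - t"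
        using mult_left_mono[of "inverse (real (Suc n))" 1 "1 / 2 - t"] 2 by (simp add: c_def)
    qed
    have ex: "(\<exists>n. t + c n \<le> z) \<longleftrightarrow> t < z" for z
    proof
      assume "\<exists>n. t + c n \<le> z"
      then obtain n where "t + c n \<le> z" by blast
      then show "t < z" using c(1)[of n] by simp
    next
      assume "t < z"
      then have "0 < (z - t) / (1 / 2 - t)" using 2 by simp
      then obtain n where "inverse (real (Suc n)) < (z - t) / (1 / 2 - t)"
        using reals_Archimedean by blast
      then have "c n < z - t"
        using 2 by (simp add: c_def pos_less_divide_eq mult.commute)
      then show "\<exists>n. t + c n \<le> z" by (intro exI[of _ n]) simp
    qed
    have lev: "AE y in N. y \<in> set_map {x\<in>space M. t + c n \<le> r x} \<longleftrightarrow> t + c n \<le> \<phi> r y" for n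
      using set_map_level(2)[OF r, of "1 - (t + c n)"] c[of n] 2 by simp
    have "AE y in N. \<forall>n. y \<in> set_map {x\<in>space M. t + c n \<le> r x} \<longleftrightarrow> t + c n \<le> \<phi> r y"
      unfolding AE_all_countable using lev by blast
    moreover have "AE y in N. y \<in> set_map (\<Union>n. {x\<in>space M. t + c n \<le> r x}) \<longleftrightarrow>
        (\<exists>n. y \<in> set_map {x\<in>space M. t + c n \<le> r x})"
      by (intro L_UN) measurable
    moreover have "(\<Union>n. {x\<in>space M. t + c n \<le> r x}) = {x\<in>space M. t < r x}"
      using ex by auto
    ultimately show ?thesis
      unfolding vim by (elim AE_mp) (auto simp: U ex intro!: AE_I2)
  next
    case 3
    then show ?thesis using set_map_level(1)[OF r 3] unfolding vim by (simp add: U)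
  next
    case 4
    have "\<not> t < r x" "\<not> t < \<phi> r y" for x y
      using 4 sphere_repD(3)[OF r, of x] sphere_repD(3)[OF p, of y] by simp_all
    then have empty: "{x\<in>space M. t < r x} = {}" and "\<phi> r y \<notin> U" for y by (simp_all add: U)
    then show ?thesis unfolding vim empty using L_empty by simp
  qed
qed

lemma hat_of_real:
  "r \<in> sphere_rep M \<Longrightarrow> hat (Linf_of_real M r) = Linf_of_real N (\<phi> r)"
  by (intro hat_class sphere_rep_Minf in_rep rel_compose[OF rel_isometry]) measurable

end

section \<open>Passage from classes to representatives and conclusion\<close>

theorem theorem15:
  fixes \<mu> :: "'a measure" and \<nu> :: "'b measure"
    and \<Phi> :: "('a \<Rightarrow> complex) set \<Rightarrow> ('b \<Rightarrow> complex) set"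
  assumes "bij_betw \<Phi> (Linf_possphere \<mu>) (Linf_possphere \<nu>)"
    and "\<And>F G. F \<in> Linf_possphere \<mu> \<Longrightarrow> G \<in> Linf_possphere \<mu> \<Longrightarrow>
      Linf_norm \<nu> (Linf_diff \<nu> (\<Phi> F) (\<Phi> G)) = Linf_norm \<mu> (Linf_diff \<mu> F G)"
  shows "\<exists>\<Lambda>. regular_set_isomorphism \<mu> \<nu> \<Lambda> \<and>
    Linf_star_isomorphism \<mu> \<nu> (Linf_hat \<mu> \<nu> \<Lambda>) \<and>
    (\<forall>F\<in>Linf_possphere \<mu>. \<Phi> F = Linf_hat \<mu> \<nu> \<Lambda> F)"
proof -
  \<comment> \<open>Each image class is given a representative in \<open>sphere_rep\<close>, which
    exists by \<open>Linf_possphere_eq\<close>; the choice is immaterial up to null sets.\<close>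
  define \<phi> where "\<phi> r = (SOME p. p \<in> sphere_rep \<nu> \<and> Linf_of_real \<nu> p = \<Phi> (Linf_of_real \<mu> r))" for r
  have \<phi>: "\<phi> r \<in> sphere_rep \<nu>" "\<Phi> (Linf_of_real \<mu> r) = Linf_of_real \<nu> (\<phi> r)" if "r \<in> sphere_rep \<mu>" for r
  proof -
    have "\<Phi> (Linf_of_real \<mu> r) \<in> Linf_possphere \<nu>"
      using bij_betwE[OF assms(1)] that by (simp add: Linf_possphere_eq)
    then have "\<exists>p. p \<in> sphere_rep \<nu> \<and> Linf_of_real \<nu> p = \<Phi> (Linf_of_real \<mu> r)"
      by (auto simp: Linf_possphere_eq)
    from someI_ex[OF this] show "\<phi> r \<in> sphere_rep \<nu>" "\<Phi> (Linf_of_real \<mu> r) = Linf_of_real \<nu> (\<phi> r)"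
      unfolding \<phi>_def by simp_all
  qed
  interpret sphere_isometry \<mu> \<nu> \<phi>
  proof
    fix r r' and s :: real assume r: "r \<in> sphere_rep \<mu>" "r' \<in> sphere_rep \<mu>" and s: "0 \<le> s"
    show "(AE y in \<nu>. \<bar>\<phi> r y - \<phi> r' y\<bar> \<le> s) \<longleftrightarrow> (AE x in \<mu>. \<bar>r x - r' x\<bar> \<le> s)"
      using assms(2)[of "Linf_of_real \<mu> r" "Linf_of_real \<mu> r'"] r
        Linf_norm_diff_of_real_le_iff[OF r s]
        Linf_norm_diff_of_real_le_iff[OF \<phi>(1)[OF r(1)] \<phi>(1)[OF r(2)] s]
      by (simp add: \<phi>(2) Linf_possphere_eq)
  next
    fix p assume p: "p \<in> sphere_rep \<nu>"
    then have "Linf_of_real \<nu> p \<in> \<Phi> ` Linf_possphere \<mu>"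
      using bij_betw_imp_surj_on[OF assms(1)] by (simp add: Linf_possphere_eq)
    then obtain r where r: "r \<in> sphere_rep \<mu>" "Linf_of_real \<nu> p = Linf_of_real \<nu> (\<phi> r)"
      using \<phi>(2) by (auto simp: Linf_possphere_eq)
    then have "AE y in \<nu>. complex_of_real (p y) = complex_of_real (\<phi> r y)"
      using Linf_class_eq_iff[OF sphere_rep_Minf[OF p] sphere_rep_Minf[OF \<phi>(1)[OF r(1)]]] by simp
    then show "\<exists>r\<in>sphere_rep \<mu>. AE y in \<nu>. \<phi> r y = p y"
      using r(1) by (intro bexI[of _ r]) auto
  qed (rule \<phi>(1))
  have "\<Phi> F = hat F" if "F \<in> Linf_possphere \<mu>" for F
    using that hat_of_real \<phi>(2) by (auto simp: Linf_possphere_eq)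
  then show ?thesis
    using hat_star_isomorphism regular_iso_axioms
    by (intro exI[of _ set_map]) (simp add: Linf_hat_eq regular_iso_iff)
qed

end
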